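(* For each integer $n\ge 0$, all of the following congruences hold: \begin{align*} \overline{SOME}(4n+2)&\equiv 0\pmod{2^5},\\ \overline{SOME}(8n+2)&\equiv 0\pmod{2^7},\\ \overline{SOME}(16n+10)&\equiv 0\pmod{2^8},\\ \overline{SOME}(16n+14)&\equiv 0\pmod{2^6},\\ \overline{SOME}(16n+12)&\equiv 0\pmod{2^5},\\ \overline{SOME}(32n+28)&\equiv 0\pmod{2^7},\\ \overline{SOME}(32n+20)&\equiv 0\pmod{2^5},\\ \overline{SOME}(32n+24)&\equiv 0\pmod{2^6},\\ \overline{SOME}(128n+80)&\equiv 0\pmod{2^7},\\ \overline{SOME}(64n+48)&\equiv 0\pmod{2^7},\\ \overline{SOME}(128n+112)&\equiv 0\pmod{2^8},\\ \overline{SOME}(128n+96)&\equiv 0\pmod{2^8},\\ \overline{SOME}(256n+192)&\equiv 0\pmod{2^9},\\ \overline{SOME}(512n+320)&\equiv 0\pmod{2^9}. \end{align*}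
   Context: An overpartition of a nonnegative integer $n$ is a partition of $n$ in which the first occurrence of each distinct part may be overlined (or not). For $n\ge 0$, $\overline{SOME}(n)$ denotes the sum, over all overpartitions $\lambda$ of $n$, of (the sum of the odd parts of $\lambda$) minus (the sum of the even parts of $\lambda$), where parts are counted with multiplicity and an overlined part counts with its numerical size. *)

theory Defs
  imports "HOL-Library.Multiset" "HOL-Number_Theory.Cong"
begin

(* An overpartition is encoded as a pair (P, D): P is the multiset of all parts (overlined or
   not), and D is the set of those part sizes whose first occurrence is overlined. *)

definition overpartitions :: "nat \<Rightarrow> (nat multiset \<times> nat set) set" where
  "overpartitions n = {(P, D). (\<forall>k\<in>#P. 0 < k) \<and> sum_mset P = n \<and> D \<subseteq> set_mset P}"

definition odd_part_sum :: "nat multiset \<times> nat set \<Rightarrow> nat" where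
  "odd_part_sum l = sum_mset (filter_mset odd (fst l))"

definition even_part_sum :: "nat multiset \<times> nat set \<Rightarrow> nat" where
  "even_part_sum l = sum_mset (filter_mset even (fst l))"

definition SOME_bar :: "nat \<Rightarrow> int" where
  "SOME_bar n = (\<Sum>l\<in>overpartitions n. int (odd_part_sum l) - int (even_part_sum l))"

(* The sum defining SOME_bar ranges over a finite set, so it is not 0 by default. *)

lemma finite_overpartitions: "finite (overpartitions n)"
proof -
  have size_le: "size P \<le> sum_mset P" if "\<forall>k\<in>#P. 0 < k" for P :: "nat multiset"
    using that by (induction P) auto
  have part_le: "k \<le> sum_mset P" if "k \<in># P" for k :: nat and P
    using that by (metis le_add1 multi_member_split sum_mset.add_mset)
  have "overpartitions n \<subseteq> (mset ` {xs. set xs \<subseteq> {..n} \<and> length xs \<le> n}) \<times> Pow {..n}"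
  proof (clarsimp simp: overpartitions_def, intro conjI)
    fix P :: "nat multiset" and D
    assume pos: "\<forall>k\<in>#P. 0 < k" and D: "D \<subseteq> set_mset P"
    obtain xs where "mset xs = P" using ex_mset by blast
    then show "P \<in> mset ` {xs. set xs \<subseteq> {..\<Sum>\<^sub># P} \<and> length xs \<le> \<Sum>\<^sub># P}"
      using size_le[OF pos] part_le by (intro image_eqI[of _ _ xs]) auto
    show "D \<subseteq> {..\<Sum>\<^sub># P}" using D part_le by blast
  qed
  then show ?thesis
    by (rule finite_subset) (simp add: finite_lists_length_le)
qed

end

theory Submission
  imports Defs "HOL-Computational_Algebra.Formal_Power_Series"
begin

unbundle fps_syntax

text \<open>
  Let $\varphi(q) = \sum_{k} q^{k^2}$, summed over all integers. An overpartition is a choice of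
  multiplicities and overlinings for each part size $k$, which contributes the factor
  $(1+q^k)/(1-q^k)$ to the generating function; by an identity of Gauss the product of these factors is
  $1/\varphi(-q)$. Weighting by the odd parts minus the even parts multiplies by an alternating sum of
  logarithmic derivatives of the factors. The substitution $q \mapsto -q$ inverts the factors for
  odd $k$ and fixes those for even $k$, so this alternating sum is the logarithmic derivative
  $q\varphi'(q)/\varphi(q)$. Together with $\varphi(q)\varphi(-q) = \varphi(-q^2)^2$ this gives
  \[ \sum_n \overline{SOME}(n)\, q^n = \frac{q\varphi'(q)}{\varphi(q)\varphi(-q)}
     = \frac{2 Z(q)}{\varphi(-q^2)^2}, \qquad Z(q) = \sum_{k \ge 1} k^2 q^{k^2}. \]
  These steps are \<open>overpart_prod_times_alt_phi\<close>, \<open>weighted_gf_log_deriv\<close>, \<open>SOME_gf_eq\<close> and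
  \<open>phi_alt_phi\<close>.

  The even arguments are extracted by two dissections. Taking even coefficients replaces $2Z(q)$ by
  $8Z(q^2)$ and $\varphi(-q^2)^2$ by $\varphi(-q)^2$. Multiplying numerator and denominator by
  $\varphi(q)^2$ makes the denominator $\varphi(-q^2)^4$, and the even and odd coefficients of
  $\varphi(q)^2 = 1 + 4\rho(q)$ then give the values at $4n$ and $4n+2$:
  \[ \varphi(-q)^4 \sum_n \overline{SOME}(4n)\, q^n = 8 Z(q) \varphi(q)^2, \qquad
     \varphi(-q)^4 \sum_n \overline{SOME}(4n+2)\, q^n = 32 Z(q) \sum_n \rho_{2n+1} q^n. \]
  Modulo 256 the first series is $8Z(1+12\rho)$ and the second one is 32 times $Z$ times the odd
  half of $\rho$; modulo 512 the first series has three further terms (\<open>SOME_0_cong_512\<close>).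

  What remains is a discussion of residues of squares. A term of $Z\rho$ belongs to a sum of
  three squares (one of them possibly zero) and carries the first square as a factor. Either the
  residue of $n$ forbids such a sum, or it forces the weighted square to be divisible by a power of 4, or the
  number of remaining representations has the required parity, by $f(q)^2 \equiv f(q^2)$ modulo 2.
  The other products are treated in the same way.
\<close>

section \<open>Substitutions and dissections of formal power series\<close>

definition stretch :: "nat \<Rightarrow> int fps \<Rightarrow> int fps" where
  "stretch k f = f oo fps_X ^ k"

definition alt :: "int fps \<Rightarrow> int fps" where
  "alt f = f oo (- fps_X)"

definition even_part :: "int fps \<Rightarrow> int fps" where
  "even_part f = Abs_fps (\<lambda>n. f $ (2 * n))"

definition odd_part :: "int fps \<Rightarrow> int fps" where
  "odd_part f = Abs_fps (\<lambda>n. f $ (2 * n + 1))"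

lemma nth_numeral_mult [simp]:
  fixes f :: "int fps"
  shows "(numeral w * f) $ n = numeral w * f $ n" "(f * numeral w) $ n = f $ n * numeral w"
  by (simp_all add: numeral_fps_const)

lemma nth_stretch:
  assumes "0 < k"
  shows "stretch k f $ n = (if k dvd n then f $ (n div k) else 0)"
proof -
  have "stretch k f $ n = (\<Sum>i=0..n. if i * k = n then f $ i else 0)"
    unfolding stretch_def fps_compose_nth
    by (intro sum.cong) (auto simp flip: power_mult simp: mult.commute)
  also have "\<dots> = (\<Sum>i=0..n. if i = n div k then (if k dvd n then f $ i else 0) else 0)"
    using assms by (intro sum.cong) auto
  also have "\<dots> = (if k dvd n then f $ (n div k) else 0)"
    by (subst sum.delta) auto
  finally show ?thesis .
qed

lemma nth_alt [simp]: "alt f $ n = (-1) ^ n * f $ n"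
  by (simp add: alt_def fps_compose_uminus')

lemma nth_even_part [simp]: "even_part f $ n = f $ (2 * n)"
  by (simp add: even_part_def)

lemma nth_odd_part [simp]: "odd_part f $ n = f $ (2 * n + 1)"
  by (simp add: odd_part_def)

lemma stretch_mult: "0 < k \<Longrightarrow> stretch k (f * g) = stretch k f * stretch k g"
  unfolding stretch_def by (rule fps_compose_mult_distrib) simp

lemma stretch_add: "stretch k (f + g) = stretch k f + stretch k g"
  unfolding stretch_def by (rule fps_compose_add_distrib)

lemma stretch_diff: "stretch k (f - g) = stretch k f - stretch k g"
  unfolding stretch_def by (rule fps_compose_sub_distrib)

lemma stretch_1 [simp]: "stretch k 1 = 1"
  by (simp add: stretch_def)

lemma stretch_fps_X: "0 < k \<Longrightarrow> stretch k fps_X = fps_X ^ k"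
  unfolding stretch_def by (simp add: fps_X_fps_compose_startby0)

lemma alt_mult: "alt (f * g) = alt f * alt g"
  unfolding alt_def by (rule fps_compose_mult_distrib) simp

lemma alt_1 [simp]: "alt 1 = 1"
  by (simp add: alt_def)

lemma nth_stretch_mult:
  assumes "0 < k"
  shows "(stretch k f * g) $ n = (\<Sum>j=0..n div k. f $ j * g $ (n - k * j))"
proof -
  have "(\<Sum>j=0..n div k. f $ j * g $ (n - k * j))
      = (\<Sum>i\<in>(\<lambda>j. k * j) ` {0..n div k}. stretch k f $ i * g $ (n - i))"
    using assms by (subst sum.reindex) (auto simp: inj_on_def nth_stretch)
  also have "\<dots> = (\<Sum>i=0..n. stretch k f $ i * g $ (n - i))"
  proof (rule sum.mono_neutral_left)
    show "(\<lambda>j. k * j) ` {0..n div k} \<subseteq> {0..n}"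
      using assms by (auto simp: less_eq_div_iff_mult_less_eq mult.commute)
    show "\<forall>i\<in>{0..n} - (\<lambda>j. k * j) ` {0..n div k}. stretch k f $ i * g $ (n - i) = 0"
      using assms by (auto simp: nth_stretch elim!: dvdE)
        (metis atLeastAtMost_iff div_le_mono imageI le0 nonzero_mult_div_cancel_left not_gr_zero)
  qed simp
  finally show ?thesis by (simp add: fps_mult_nth)
qed

text \<open>Series in the squared variable act as scalars for both halves of the dissection; this is
  what lets an equation be split after one factor has been rewritten in the squared variable.\<close>

lemma even_part_stretch_mult: "even_part (stretch 2 f * g) = f * even_part g"
proof (rule fps_ext)
  fix n
  have e: "2 * n - 2 * j = 2 * (n - j)" for j :: nat
    by simp
  show "even_part (stretch 2 f * g) $ n = (f * even_part g) $ n"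
    unfolding nth_even_part nth_stretch_mult[OF zero_less_numeral] e
    by (simp add: fps_mult_nth)
qed

lemma odd_part_stretch_mult: "odd_part (stretch 2 f * g) = f * odd_part g"
proof (rule fps_ext)
  fix n
  have e: "2 * n + 1 - 2 * j = 2 * (n - j) + 1" if "j \<in> {0..n}" for j :: nat
    using that by simp
  have d: "(2 * n + 1) div 2 = n" by simp
  show "odd_part (stretch 2 f * g) $ n = (f * odd_part g) $ n"
    unfolding nth_odd_part nth_stretch_mult[OF zero_less_numeral] d fps_mult_nth[of f]
    by (intro sum.cong refl) (simp only: e)
qed

section \<open>Gauss's q_deriv series is inverse to the overpartition product\<close>

text \<open>The factor $(1 + q^k)/(1 - q^k) = 1 + 2 q^k + 2 q^{2k} + \dots$ of the overpartition generating
  function: a part size that occurs at all can have its first occurrence overlined or not.\<close>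

definition overpart_factor :: "nat \<Rightarrow> int fps" where
  "overpart_factor k = stretch k (Abs_fps (\<lambda>j. if j = 0 then 1 else 2))"

definition overpart_prod :: "nat \<Rightarrow> int fps" where
  "overpart_prod n = (\<Prod>k=1..n. overpart_factor k)"

lemma overpart_factor_eq:
  assumes "0 < k"
  shows "overpart_factor k * (1 - fps_X ^ k) = 1 + fps_X ^ k"
proof -
  define c :: "int fps" where "c = Abs_fps (\<lambda>j. if j = 0 then 1 else 2)"
  have "c * (1 - fps_X) = 1 + fps_X"
    by (rule fps_ext) (auto simp: c_def algebra_simps fps_X_mult_right_nth)
  then have "stretch k (c * (1 - fps_X)) = stretch k (1 + fps_X)" by simp
  then show ?thesis
    using assms by (simp add: stretch_mult stretch_diff stretch_add stretch_fps_X
        overpart_factor_def c_def)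
qed

lemma overpart_prod_0 [simp]: "overpart_prod 0 = 1"
  by (simp add: overpart_prod_def)

lemma overpart_prod_Suc: "overpart_prod (Suc n) = overpart_prod n * overpart_factor (Suc n)"
  by (simp add: overpart_prod_def)

lemma one_minus_X_power_nonzero: "0 < k \<Longrightarrow> 1 - fps_X ^ k \<noteq> (0 :: int fps)"
  by (metis diff_0_right fps_X_power_nth fps_one_nth fps_sub_nth fps_zero_nth less_not_refl zero_neq_one)

lemma telescoping_alternating_sum:
  fixes v :: "nat \<Rightarrow> 'a :: comm_ring_1"
  shows "(\<Sum>s=0..n. (-1) ^ s * (v s + (if s = 0 then 0 else v (s - 1)))) = (-1) ^ n * v n"
  by (induction n) (auto simp: algebra_simps)

text \<open>A finite form of Gauss's identity, in the manner of Shanks. Let $O_n$ be the product over the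
  part sizes up to $n$ and $S_n$ the truncated theta series at $-q$. The right-hand side starts with
  $1$ and all its other terms have order above $n$, so that the identity exhibits
  $O_n S_n = 1 + O(q^{n+1})$. The induction telescopes: if $R_n$ denotes the right-hand side, then the
  terms of $(1 - q^{n+1}) R_{n+1} - (1 + q^{n+1}) R_n$ form an alternating sum of neighbours $v_{s-1} + v_s$,
  up to the new last term.
  The series $t_s$ stand for $2/(1+q^s)$.\<close>

lemma finite_gauss_identity:
  fixes t :: "nat \<Rightarrow> int fps"
  assumes t: "\<And>s. (1 + fps_X ^ s) * t s = 2"
  shows "overpart_prod n * (1 + 2 * (\<Sum>k=1..n. (-1) ^ k * fps_X ^ k\<^sup>2))
       = (\<Sum>s=0..n. (-1) ^ s * overpart_prod s * t s * fps_X ^ (s * (n + 1)))"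
proof (induction n)
  case 0
  have "2 * t 0 = 2 * 1" using t[of 0] by simp
  then have "t 0 = 1" by (subst (asm) mult_cancel_left) simp
  then show ?case by simp
next
  case (Suc n)
  let ?X = "fps_X :: int fps"
  let ?O = overpart_prod
  let ?m = "Suc n"
  define S where "S = 1 + 2 * (\<Sum>k=1..n. (-1) ^ k * ?X ^ k\<^sup>2)"
  define R where "R = (\<Sum>s=0..n. (-1) ^ s * ?O s * t s * ?X ^ (s * (n + 1)))"
  define R' where "R' = (\<Sum>s=0..n. (-1) ^ s * ?O s * t s * ?X ^ (s * (n + 2)))"
  \<comment> \<open>The telescoping quantity; for the predecessor of 0 it has to be read as 0.\<close>
  define v where "v = (\<lambda>s. 2 * ?O s * ?X ^ (Suc s * ?m))"
  have key: "?O s * t s * (1 - ?X ^ s) = (if s = 0 then 0 else 2 * ?O (s - 1))" for s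
  proof (cases s)
    case (Suc r)
    have "?O s * t s * (1 - ?X ^ s) = ?O r * (overpart_factor s * (1 - ?X ^ s)) * t s"
      by (simp add: Suc overpart_prod_Suc algebra_simps)
    also have "\<dots> = ?O r * ((1 + ?X ^ s) * t s)"
      using Suc by (simp only: overpart_factor_eq mult.assoc zero_less_Suc)
    finally show ?thesis unfolding t by (simp add: Suc mult.commute)
  qed simp
  have "(1 - ?X ^ ?m) * R' - (1 + ?X ^ ?m) * R
      = (\<Sum>s=0..n. - ((-1) ^ s * (v s + (if s = 0 then 0 else v (s - 1)))))"
    unfolding R_def R'_def sum_distrib_left sum_subtractf[symmetric]
  proof (rule sum.cong)
    fix s assume "s \<in> {0..n}"
    have e: "?X ^ (s * (n + 2)) = ?X ^ (s * ?m) * ?X ^ s"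
      by (simp flip: power_add add: algebra_simps)
    have e2: "?X ^ (Suc s * ?m) = ?X ^ (s * ?m) * ?X ^ ?m"
      by (simp flip: power_add add: algebra_simps)
    have vs: "v s = ?O s * ((1 + ?X ^ s) * t s) * (?X ^ (s * ?m) * ?X ^ ?m)"
      unfolding v_def e2 t by (simp add: algebra_simps)
    have vp: "(if s = 0 then 0 else v (s - 1)) = ?O s * t s * (1 - ?X ^ s) * ?X ^ (s * ?m)"
      unfolding key v_def by (cases s) simp_all
    show "(1 - ?X ^ ?m) * ((-1) ^ s * ?O s * t s * ?X ^ (s * (n + 2)))
        - (1 + ?X ^ ?m) * ((-1) ^ s * ?O s * t s * ?X ^ (s * (n + 1)))
        = - ((-1) ^ s * (v s + (if s = 0 then 0 else v (s - 1))))"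
      unfolding vs vp e by (simp add: algebra_simps)
  qed simp
  also have "\<dots> = - ((-1) ^ n * v n)"
    unfolding sum_negf telescoping_alternating_sum ..
  finally have diff: "(1 - ?X ^ ?m) * R' = (1 + ?X ^ ?m) * R - (-1) ^ n * v n"
    by (simp add: algebra_simps)
  have fac: "(1 - ?X ^ ?m) * ?O ?m = ?O n * (1 + ?X ^ ?m)"
    unfolding overpart_prod_Suc overpart_factor_eq[OF zero_less_Suc, symmetric]
    by (simp only: ac_simps)
  have last: "(1 - ?X ^ ?m) * (?O ?m * t ?m) = 2 * ?O n"
    using key[of ?m] by (simp only: ac_simps) simp
  have vn: "v n = 2 * ?O n * ?X ^ ?m\<^sup>2" by (simp add: v_def power2_eq_square)
  have e3: "?X ^ (?m * (?m + 1)) = ?X ^ ?m\<^sup>2 * ?X ^ ?m"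
    by (simp flip: power_add add: algebra_simps power2_eq_square)
  have "(1 - ?X ^ ?m) * (?O ?m * (S + 2 * (-1) ^ ?m * ?X ^ ?m\<^sup>2))
      = ((1 - ?X ^ ?m) * ?O ?m) * (S + 2 * (-1) ^ ?m * ?X ^ ?m\<^sup>2)"
    by (simp only: mult.assoc)
  also have "\<dots> = (1 + ?X ^ ?m) * (?O n * S)
      + (1 + ?X ^ ?m) * ?O n * (2 * (-1) ^ ?m * ?X ^ ?m\<^sup>2)"
    unfolding fac by (simp only: algebra_simps)
  also have "?O n * S = R" using Suc.IH by (simp add: S_def R_def)
  also have "(1 + ?X ^ ?m) * R + (1 + ?X ^ ?m) * ?O n * (2 * (-1) ^ ?m * ?X ^ ?m\<^sup>2)
      = (1 - ?X ^ ?m) * R' + (-1) ^ ?m * ((1 - ?X ^ ?m) * (?O ?m * t ?m)) * ?X ^ (?m * (?m + 1))"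
    unfolding diff last vn e3 by (simp add: algebra_simps)
  also have "\<dots> = (1 - ?X ^ ?m) * (R' + (-1) ^ ?m * ?O ?m * t ?m * ?X ^ (?m * (?m + 1)))"
    by (simp only: algebra_simps)
  finally have "?O ?m * (S + 2 * (-1) ^ ?m * ?X ^ ?m\<^sup>2)
      = R' + (-1) ^ ?m * ?O ?m * t ?m * ?X ^ (?m * (?m + 1))"
    using one_minus_X_power_nonzero[of ?m] by (subst (asm) mult_cancel_left) simp
  then show ?case
    by (simp add: S_def R'_def algebra_simps)
qed

definition sq :: "int fps" where
  "sq = Abs_fps (\<lambda>n. of_bool (0 < n \<and> (\<exists>k. n = k\<^sup>2)))"

definition phi :: "int fps" where
  "phi = 1 + 2 * sq"

lemma nth_sq: "sq $ n = of_bool (0 < n \<and> (\<exists>k. n = k\<^sup>2))"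
  by (simp add: sq_def)

lemma nth_phi: "phi $ n = (if n = 0 then 1 else if \<exists>k. n = k\<^sup>2 then 2 else 0)"
  by (simp add: phi_def nth_sq)

lemma phi_partial_sum:
  assumes "i \<le> n"
  shows "(1 + 2 * (\<Sum>k=1..n. (-1) ^ k * fps_X ^ k\<^sup>2)) $ i = alt phi $ i"
proof -
  have c: "((-1) ^ k * fps_X ^ k\<^sup>2 :: int fps) $ i = (if i = k\<^sup>2 then (-1) ^ k else 0)" for k
    by (cases "even k") auto
  have sum: "(1 + 2 * (\<Sum>k=1..n. (-1) ^ k * fps_X ^ k\<^sup>2 :: int fps)) $ i
      = (if i = 0 then 1 else 0) + 2 * (\<Sum>k=1..n. if i = k\<^sup>2 then (-1) ^ k else 0)"
    by (simp only: fps_add_nth fps_one_nth nth_numeral_mult fps_sum_nth c)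
  show ?thesis
  proof (cases "\<exists>k. i = k\<^sup>2")
    case True
    then obtain m where m: "i = m\<^sup>2" by blast
    have "m \<le> n" using assms m by (metis le_trans power2_nat_le_imp_le power2_nat_le_eq_le)
    have "(\<Sum>k=1..n. if i = k\<^sup>2 then (-1) ^ k else 0 :: int)
        = (\<Sum>k=1..n. if k = m then (-1) ^ m else 0)"
      by (intro sum.cong) (auto simp: m)
    also have "\<dots> = (if m = 0 then 0 else (-1) ^ m)"
      using \<open>m \<le> n\<close> by (subst sum.delta) auto
    finally show ?thesis
      unfolding sum by (auto simp: nth_phi m minus_one_power_iff)
  next
    case False
    then have "(\<Sum>k=1..n. if i = k\<^sup>2 then (-1) ^ k else 0 :: int) = 0"
      by (intro sum.neutral) auto
    moreover from False have "i \<noteq> 0" by (metis zero_power2)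
    ultimately show ?thesis using False unfolding sum by (simp add: nth_phi)
  qed
qed

lemma fps_X_power_dvd_iff: "fps_X ^ m dvd (f :: int fps) \<longleftrightarrow> (\<forall>i<m. f $ i = 0)"
proof
  assume "\<forall>i<m. f $ i = 0"
  then have "f = fps_X ^ m * fps_shift m f"
    by (intro fps_ext) (auto simp: fps_X_power_mult_nth)
  then show "fps_X ^ m dvd f" by (metis dvd_triv_left)
qed (auto simp: fps_X_power_mult_nth elim!: dvdE)

text \<open>This is Gauss's identity $\prod_k (1+q^k)/(1-q^k) \cdot \varphi(-q) = 1$, with the infinite
  product replaced by its partial products.\<close>

lemma overpart_prod_times_alt_phi:
  "fps_X ^ (n + 1) dvd overpart_prod n * alt phi - 1"
proof -
  define S :: "int fps" where "S = 1 + 2 * (\<Sum>k=1..n. (-1) ^ k * fps_X ^ k\<^sup>2)"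
  define t :: "nat \<Rightarrow> int fps" where
    "t = (\<lambda>s. if s = 0 then 1 else 2 * fps_right_inverse (1 + fps_X ^ s) 1)"
  have t: "(1 + fps_X ^ s) * t s = 2" for s
  proof (cases "s = 0")
    case False
    then have "(1 + fps_X ^ s) * fps_right_inverse (1 + fps_X ^ s) 1 = (1 :: int fps)"
      by (intro fps_right_inverse) simp
    then show ?thesis using False by (simp add: t_def)
  qed (simp add: t_def)
  have split: "overpart_prod n * S
      = 1 + (\<Sum>s=1..n. (-1) ^ s * overpart_prod s * t s * fps_X ^ (s * (n + 1)))"
    unfolding S_def finite_gauss_identity[OF t]
    by (simp add: sum.atLeast_Suc_atMost t_def)
  have "fps_X ^ (n + 1) dvd (\<Sum>s=1..n. (-1) ^ s * overpart_prod s * t s * fps_X ^ (s * (n + 1)))"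
    by (intro dvd_sum dvd_mult le_imp_power_dvd) (simp del: mult_Suc_right)
  then have 1: "fps_X ^ (n + 1) dvd overpart_prod n * S - 1"
    by (simp only: split add_diff_cancel_left')
  have "fps_X ^ (n + 1) dvd alt phi - S"
    unfolding fps_X_power_dvd_iff using phi_partial_sum[of _ n] by (auto simp: S_def)
  then have "fps_X ^ (n + 1) dvd overpart_prod n * (alt phi - S) + (overpart_prod n * S - 1)"
    using 1 by (intro dvd_add dvd_mult)
  then show ?thesis by (simp add: algebra_simps)
qed

section \<open>The generating function of the weighted overpartition count\<close>

text \<open>The weight depends only on the underlying partition; overlining merely multiplies the number of
  times that a partition is counted by a power of two.\<close>

definition part_weight :: "nat multiset \<Rightarrow> int" where
  "part_weight P = (\<Sum>k\<in>#P. (-1) ^ (k + 1) * int k)"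

lemma weight_eq_part_weight: "int (odd_part_sum l) - int (even_part_sum l) = part_weight (fst l)"
proof -
  have "int (sum_mset (filter_mset odd P)) - int (sum_mset (filter_mset even P)) = part_weight P"
    for P by (induction P) (auto simp: part_weight_def)
  then show ?thesis by (simp add: odd_part_sum_def even_part_sum_def)
qed

lemma member_le_sum_mset:
  fixes k :: nat
  assumes "k \<in># P"
  shows "k \<le> sum_mset P"
  using assms by (metis le_add1 multi_member_split sum_mset.add_mset)

lemma sum_mset_replicate_nat: "sum_mset (replicate_mset j k) = j * (k::nat)"
  by (induction j) auto

definition parts_le :: "nat \<Rightarrow> nat \<Rightarrow> nat multiset set" where
  "parts_le m n = {P. (\<forall>k\<in>#P. 0 < k \<and> k \<le> m) \<and> sum_mset P = n}"

lemma parts_le_self: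
  "n \<le> m \<Longrightarrow> parts_le m n = {P. (\<forall>k\<in>#P. 0 < k) \<and> sum_mset P = n}"
  using member_le_sum_mset by (force simp: parts_le_def)

lemma overpartitions_Sigma: "overpartitions n = Sigma (parts_le n n) (\<lambda>P. Pow (set_mset P))"
  by (auto simp: overpartitions_def parts_le_self)

lemma finite_parts_le [simp]: "finite (parts_le m n)"
proof (rule finite_subset)
  show "parts_le m n \<subseteq> fst ` overpartitions n"
    by (force simp: overpartitions_def parts_le_def image_iff)
qed (simp add: finite_overpartitions)

lemma sum_overpartitions:
  "(\<Sum>l\<in>overpartitions n. f (fst l)) = (\<Sum>P\<in>parts_le n n. 2 ^ card (set_mset P) * (f P :: int))"
proof -
  have "(\<Sum>l\<in>overpartitions n. f (fst l))
      = (\<Sum>(P, D)\<in>Sigma (parts_le n n) (\<lambda>P. Pow (set_mset P)). f P)"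
    by (simp only: overpartitions_Sigma split_def)
  also have "\<dots> = (\<Sum>P\<in>parts_le n n. \<Sum>D\<in>Pow (set_mset P). f P)"
    by (rule sum.Sigma[symmetric]) simp_all
  finally show ?thesis by (simp add: card_Pow)
qed

text \<open>Splitting off the copies of the largest admissible part size is what turns sums over partitions
  into products of power series.\<close>

lemma parts_le_Suc:
  "parts_le (Suc m) n =
     (\<Union>j\<in>{0..n div Suc m}. (\<lambda>P. P + replicate_mset j (Suc m)) ` parts_le m (n - Suc m * j))"
  (is "_ = ?R")
proof (intro equalityI subsetI)
  fix P assume P: "P \<in> parts_le (Suc m) n"
  define j where "j = count P (Suc m)"
  define Q where "Q = filter_mset (\<lambda>k. k \<noteq> Suc m) P"
  have PQ: "P = Q + replicate_mset j (Suc m)"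
    unfolding Q_def j_def by (rule multiset_eqI) auto
  have "sum_mset Q + j * Suc m = n"
    using P by (simp add: parts_le_def PQ sum_mset_replicate_nat)
  then have "Suc m * j \<le> n" "sum_mset Q = n - Suc m * j" by (auto simp: algebra_simps)
  moreover from this have "j \<le> n div Suc m"
    by (simp add: less_eq_div_iff_mult_less_eq mult.commute del: mult_Suc mult_Suc_right)
  moreover have "0 < k \<and> k \<le> m" if "k \<in># Q" for k
  proof -
    have "k \<in># P" "k \<noteq> Suc m" using that by (auto simp: Q_def)
    then show ?thesis using P by (force simp: parts_le_def)
  qed
  ultimately have "Q \<in> parts_le m (n - Suc m * j)" "j \<in> {0..n div Suc m}"
    by (auto simp: parts_le_def)
  then show "P \<in> ?R" using PQ by blast
next
  fix P assume "P \<in> ?R"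
  then obtain j Q where j: "j \<le> n div Suc m" and P: "P = Q + replicate_mset j (Suc m)"
    and Q: "Q \<in> parts_le m (n - Suc m * j)" by auto
  have "Suc m * j \<le> n"
    using j by (simp add: less_eq_div_iff_mult_less_eq mult.commute del: mult_Suc mult_Suc_right)
  then have "sum_mset P = n"
    using Q unfolding P by (simp add: parts_le_def sum_mset_replicate_nat mult.commute
        del: mult_Suc mult_Suc_right)
  then show "P \<in> parts_le (Suc m) n"
    using Q unfolding P by (force simp: parts_le_def split: if_splits)
qed

lemma inj_on_add_replicate: "inj_on (\<lambda>P. P + replicate_mset j k) A"
  by (auto simp: inj_on_def)

lemma sum_parts_le_Suc:
  fixes f :: "nat multiset \<Rightarrow> int"
  shows "(\<Sum>P\<in>parts_le (Suc m) n. f P)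
    = (\<Sum>j=0..n div Suc m. \<Sum>P\<in>parts_le m (n - Suc m * j). f (P + replicate_mset j (Suc m)))"
proof -
  let ?A = "\<lambda>j. (\<lambda>P. P + replicate_mset j (Suc m)) ` parts_le m (n - Suc m * j)"
  have notin: "count P (Suc m) = 0" if "P \<in> parts_le m i" for P i
    using that by (auto simp: parts_le_def count_eq_zero_iff)
  have "(\<Sum>P\<in>parts_le (Suc m) n. f P)
      = (\<Sum>j=0..n div Suc m. \<Sum>P\<in>?A j. f P)"
    unfolding parts_le_Suc
  proof (rule sum.UNION_disjoint)
    show "\<forall>i\<in>{0..n div Suc m}. \<forall>j\<in>{0..n div Suc m}. i \<noteq> j \<longrightarrow> ?A i \<inter> ?A j = {}"
    proof (intro ballI impI)
      fix i j :: nat assume "i \<noteq> j"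
      have count: "count P (Suc m) = l" if "P \<in> ?A l" for l P
        using that notin by auto
      show "?A i \<inter> ?A j = {}"
      proof (rule equals0I)
        fix P assume "P \<in> ?A i \<inter> ?A j"
        then have "count P (Suc m) = i" "count P (Suc m) = j" by (simp_all only: Int_iff count)
        then show False using \<open>i \<noteq> j\<close> by simp
      qed
    qed
  qed simp_all
  also have "\<dots> = (\<Sum>j=0..n div Suc m. \<Sum>P\<in>parts_le m (n - Suc m * j). f (P + replicate_mset j (Suc m)))"
    by (rule sum.cong[OF refl]) (rule sum.reindex[OF inj_on_add_replicate, unfolded o_def])
  finally show ?thesis .
qed

lemma card_set_add_replicate:
  assumes "P \<in> parts_le m i"
  shows "card (set_mset (P + replicate_mset j (Suc m))) = card (set_mset P) + (if j = 0 then 0 else 1)"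
proof -
  have "Suc m \<notin># P" using assms by (auto simp: parts_le_def)
  then show ?thesis by simp
qed

lemma part_weight_add_replicate:
  "part_weight (P + replicate_mset j k) = part_weight P + int j * ((-1) ^ (k + 1) * int k)"
  by (simp add: part_weight_def)

definition weighted_gf :: "nat \<Rightarrow> int fps" where
  "weighted_gf m = Abs_fps (\<lambda>n. \<Sum>P\<in>parts_le m n. 2 ^ card (set_mset P) * part_weight P)"

text \<open>The Euler operator $q\,d/dq$, a derivation that multiplies the coefficient of $q^n$ by $n$.\<close>

definition q_deriv :: "int fps \<Rightarrow> int fps" where
  "q_deriv f = fps_X * fps_deriv f"

lemma nth_q_deriv [simp]: "q_deriv f $ n = int n * f $ n"
  by (cases n) (simp_all add: q_deriv_def)

lemma q_deriv_mult: "q_deriv (f * g) = q_deriv f * g + f * q_deriv g"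
  by (simp add: q_deriv_def algebra_simps)

lemma q_deriv_1 [simp]: "q_deriv 1 = 0"
  by (simp add: q_deriv_def)

lemma parts_le_0: "parts_le 0 n = (if n = 0 then {{#}} else {})"
proof -
  have "P = {#}" if "P \<in> parts_le 0 n" for P
    using that by (cases P) (auto simp: parts_le_def)
  moreover have "{#} \<in> parts_le 0 n \<longleftrightarrow> n = 0" by (auto simp: parts_le_def)
  ultimately show ?thesis by auto
qed

lemma overpart_prod_gf: "overpart_prod m $ n = (\<Sum>P\<in>parts_le m n. 2 ^ card (set_mset P))"
proof (induction m arbitrary: n)
  case 0
  then show ?case by (simp add: parts_le_0)
next
  case (Suc m)
  have "overpart_prod (Suc m) $ n
      = (\<Sum>j=0..n div Suc m. (if j = 0 then 1 else 2) * overpart_prod m $ (n - Suc m * j))"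
    unfolding overpart_prod_Suc mult.commute[of "overpart_prod m"] overpart_factor_def
    by (subst nth_stretch_mult) simp_all
  also have "\<dots> = (\<Sum>P\<in>parts_le (Suc m) n. 2 ^ card (set_mset P))"
    unfolding sum_parts_le_Suc Suc.IH sum_distrib_left
    by (intro sum.cong refl) (simp only: card_set_add_replicate, simp)
  finally show ?case .
qed

text \<open>Allowing a new part size $k$ that occurs $j$ times adds $\pm jk$ to the weight, and weighting
  the terms of a factor by $jk$ is the same as applying the Euler operator to it.\<close>

lemma weighted_gf_Suc:
  "weighted_gf (Suc m) = weighted_gf m * overpart_factor (Suc m)
     + (-1) ^ m * (overpart_prod m * q_deriv (overpart_factor (Suc m)))"
proof (rule fps_ext)
  fix n
  let ?c = "\<lambda>j::nat. if j = 0 then 1 else 2 :: int"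
  have deriv_factor: "q_deriv (overpart_factor k) = stretch k (Abs_fps (\<lambda>j. int (j * k) * ?c j))"
    if "0 < k" for k
  proof (rule fps_ext)
    fix i show "q_deriv (overpart_factor k) $ i = stretch k (Abs_fps (\<lambda>j. int (j * k) * ?c j)) $ i"
      unfolding overpart_factor_def nth_q_deriv nth_stretch[OF that] fps_nth_Abs_fps
      by (cases "k dvd i") (simp_all only: dvd_div_mult_self if_True if_False mult_zero_right)
  qed
  have sign: "((-1) ^ m * f :: int fps) $ n = (-1) ^ m * f $ n" for f
    by (cases "even m") simp_all
  have "weighted_gf (Suc m) $ n
      = (\<Sum>j=0..n div Suc m. \<Sum>P\<in>parts_le m (n - Suc m * j).
          2 ^ card (set_mset P) * ?c j * (part_weight P + int j * ((-1) ^ m * int (Suc m))))"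
    unfolding weighted_gf_def fps_nth_Abs_fps sum_parts_le_Suc
    by (intro sum.cong refl) (simp only: card_set_add_replicate part_weight_add_replicate, simp)
  also have "\<dots> = (\<Sum>j=0..n div Suc m. ?c j * weighted_gf m $ (n - Suc m * j))
      + (-1) ^ m * (\<Sum>j=0..n div Suc m. int (j * Suc m) * ?c j * overpart_prod m $ (n - Suc m * j))"
    unfolding overpart_prod_gf weighted_gf_def fps_nth_Abs_fps sum_distrib_left sum.distrib[symmetric]
    by (intro sum.cong refl) (simp add: algebra_simps)
  also have "\<dots> = (weighted_gf m * overpart_factor (Suc m)
     + (-1) ^ m * (overpart_prod m * q_deriv (overpart_factor (Suc m)))) $ n"
    unfolding fps_add_nth sign mult.commute[of "overpart_prod m"] mult.commute[of "weighted_gf m"]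
      deriv_factor[OF zero_less_Suc] 
    unfolding overpart_factor_def nth_stretch_mult[OF zero_less_Suc]
    by simp
  finally show "weighted_gf (Suc m) $ n = (weighted_gf m * overpart_factor (Suc m)
     + (-1) ^ m * (overpart_prod m * q_deriv (overpart_factor (Suc m)))) $ n" .
qed

lemma alt_overpart_factor_even:
  "even k \<Longrightarrow> 0 < k \<Longrightarrow> alt (overpart_factor k) = overpart_factor k"
  by (rule fps_ext) (auto simp: overpart_factor_def nth_stretch minus_one_power_iff)

lemma alt_overpart_factor_odd:
  assumes "odd k"
  shows "overpart_factor k * alt (overpart_factor k) = 1"
proof -
  have k: "0 < k" using assms by (rule odd_pos)
  have "alt (overpart_factor k * (1 - fps_X ^ k)) = alt (1 + fps_X ^ k)"
    using k by (simp only: overpart_factor_eq)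
  moreover have "alt (1 - fps_X ^ k) = 1 + fps_X ^ k" "alt (1 + fps_X ^ k) = 1 - fps_X ^ k"
    using assms k by (auto intro!: fps_ext)
  ultimately have alt: "alt (overpart_factor k) * (1 + fps_X ^ k) = 1 - fps_X ^ k"
    by (simp add: alt_mult)
  have "overpart_factor k * alt (overpart_factor k) * (1 - fps_X ^ k)
      = alt (overpart_factor k) * (overpart_factor k * (1 - fps_X ^ k))"
    by (simp only: ac_simps)
  also have "\<dots> = 1 * (1 - fps_X ^ k)"
    using k by (simp only: overpart_factor_eq alt mult_1)
  finally show ?thesis
    using one_minus_X_power_nonzero[OF k] by (subst (asm) mult_cancel_right) simp
qed

text \<open>The alternating sign in the weight is produced by the substitution $q \mapsto -q$: it fixes the
  factor of an even part size and inverts the factor of an odd one, hence negates its logarithmic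
  derivative. Writing $O(q)$ for the product, the weighted series is therefore
  $- O(q)\, \cdot q\,\frac{d}{dq} \log O(-q)$; here denominators are cleared.\<close>

lemma weighted_gf_log_deriv:
  "weighted_gf m * alt (overpart_prod m) + overpart_prod m * q_deriv (alt (overpart_prod m)) = 0"
proof (induction m)
  case 0
  have "weighted_gf 0 = 0"
    by (rule fps_ext) (simp add: weighted_gf_def parts_le_0 part_weight_def)
  then show ?case by simp
next
  case (Suc m)
  let ?W = "weighted_gf m" and ?O = "overpart_prod m" and ?B = "alt (overpart_prod m)"
  let ?g = "overpart_factor (Suc m)" and ?h = "alt (overpart_factor (Suc m))"
  \<comment> \<open>Vanishes because the second factor is the first one or its inverse, according to the parity.\<close>
  have cross: "(-1) ^ m * (q_deriv ?g * ?h) + ?g * q_deriv ?h = 0"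
  proof (cases "even m")
    case True
    then have "q_deriv (?g * ?h) = 0" by (simp add: alt_overpart_factor_odd)
    then show ?thesis using True by (simp add: q_deriv_mult)
  next
    case False
    then show ?thesis by (simp add: alt_overpart_factor_even)
  qed
  have "weighted_gf (Suc m) * alt (overpart_prod (Suc m))
        + overpart_prod (Suc m) * q_deriv (alt (overpart_prod (Suc m)))
      = ?g * ?h * (?W * ?B + ?O * q_deriv ?B)
        + ?O * ?B * ((-1) ^ m * (q_deriv ?g * ?h) + ?g * q_deriv ?h)"
    by (simp add: weighted_gf_Suc overpart_prod_Suc alt_mult q_deriv_mult algebra_simps)
  then show ?case by (simp only: Suc.IH cross) simp
qed

definition SOME_gf :: "int fps" where
  "SOME_gf = Abs_fps SOME_bar"

lemma nth_weighted_gf: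
  assumes "n \<le> m"
  shows "weighted_gf m $ n = SOME_bar n"
proof -
  have "SOME_bar n = (\<Sum>l\<in>overpartitions n. part_weight (fst l))"
    by (simp only: SOME_bar_def weight_eq_part_weight)
  also have "\<dots> = weighted_gf m $ n"
    using assms by (simp only: sum_overpartitions) (simp add: weighted_gf_def parts_le_self)
  finally show ?thesis by simp
qed

lemma alt_alt [simp]: "alt (alt f) = f"
  by (rule fps_ext) (simp flip: power_add mult.assoc)

lemma alt_diff: "alt (f - g) = alt f - alt g"
  by (rule fps_ext) (simp add: algebra_simps)

text \<open>Inserting $O(q) = 1/\varphi(-q)$ into the logarithmic derivative formula gives
  $q \varphi'(q) / (\varphi(q)\varphi(-q))$. The coefficient of $q^n$ only sees part sizes up to $n$, so
  the approximate form of Gauss's identity modulo $q^{n+1}$ suffices.\<close>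

lemma SOME_gf_eq: "SOME_gf * (phi * alt phi) = q_deriv phi"
proof (rule fps_ext)
  fix n
  let ?W = "weighted_gf n" and ?O = "overpart_prod n" and ?B = "alt (overpart_prod n)"
  let ?I = "fps_X ^ (n + 1) :: int fps"
  have 1: "?I dvd ?O * alt phi - 1" by (rule overpart_prod_times_alt_phi)
  then have "?I dvd alt (?O * alt phi - 1)"
    unfolding fps_X_power_dvd_iff by simp
  then have 2: "?I dvd ?B * phi - 1" by (simp add: alt_mult alt_diff)
  then have "?I dvd q_deriv (?B * phi - 1)"
    unfolding fps_X_power_dvd_iff by simp
  then have 3: "?I dvd q_deriv ?B * phi + ?B * q_deriv phi"
    by (simp add: q_deriv_def algebra_simps)
  \<comment> \<open>A combination of quantities that vanish modulo the power of $q$.\<close>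
  have "?W * (phi * alt phi) - q_deriv phi
      = (?W * ?B + ?O * q_deriv ?B) * (phi\<^sup>2 * alt phi)
        - (?B * phi - 1) * (?W * phi * alt phi)
        - (?O * alt phi) * phi * (q_deriv ?B * phi + ?B * q_deriv phi)
        + (?O * alt phi) * q_deriv phi * (?B * phi - 1) 
        + q_deriv phi * (?O * alt phi - 1)"
    by (simp add: algebra_simps power2_eq_square)
  also have "?I dvd \<dots>"
    unfolding weighted_gf_log_deriv
    by (intro dvd_add dvd_diff dvd_mult 1 2 3 dvd_mult2) simp_all
  finally have "(?W * (phi * alt phi)) $ n = q_deriv phi $ n"
    unfolding fps_X_power_dvd_iff by (simp del: nth_q_deriv)
  moreover have "(?W * (phi * alt phi)) $ n = (SOME_gf * (phi * alt phi)) $ n"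
    by (simp add: fps_mult_nth SOME_gf_def nth_weighted_gf)
  ultimately show "(SOME_gf * (phi * alt phi)) $ n = q_deriv phi $ n" by simp
qed

section \<open>The doubling identity for sums of two squares\<close>

lemma nth_phi_card: "phi $ n = int (card {x :: int. x\<^sup>2 = int n})"
proof (cases "\<exists>k. n = k\<^sup>2")
  case True
  then obtain k where k: "n = k\<^sup>2" by blast
  have "{x :: int. x\<^sup>2 = int n} = {int k, - int k}"
    by (auto simp: k power2_eq_iff)
  then show ?thesis using True by (auto simp: nth_phi k)
next
  case False
  have "x\<^sup>2 \<noteq> int n" for x :: int
  proof
    assume "x\<^sup>2 = int n"
    then have "int ((nat \<bar>x\<bar>)\<^sup>2) = int n" by simp
    then show False using False by (metis of_nat_eq_iff)
  qed
  then have none: "{x :: int. x\<^sup>2 = int n} = {}" by blast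
  from False have "n \<noteq> 0" by (metis zero_power2)
  then show ?thesis using False none by (simp add: nth_phi)
qed

lemma nth_phi_square: "(phi\<^sup>2) $ n = int (card {(x :: int, y :: int). x\<^sup>2 + y\<^sup>2 = int n})"
proof -
  define A where "A = (\<lambda>i. {x :: int. x\<^sup>2 = int i})"
  have fin: "finite (A i)" for i
  proof (rule finite_subset)
    show "A i \<subseteq> {- int i..int i}"
    proof
      fix x assume "x \<in> A i"
      then have "\<bar>x\<bar>\<^sup>2 = int i" by (simp add: A_def)
      moreover have "\<bar>x\<bar> \<le> \<bar>x\<bar>\<^sup>2"
        using self_le_power[of "\<bar>x\<bar>" 2] by (cases "x = 0") (simp_all del: power2_abs)
      ultimately show "x \<in> {- int i..int i}" by auto
    qed
  qed simp
  have "{(x :: int, y :: int). x\<^sup>2 + y\<^sup>2 = int n} = (\<Union>i\<in>{0..n}. A i \<times> A (n - i))"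
  proof (intro equalityI subsetI)
    fix p :: "int \<times> int" assume "p \<in> {(x, y). x\<^sup>2 + y\<^sup>2 = int n}"
    then obtain x y where p: "p = (x, y)" "x\<^sup>2 + y\<^sup>2 = int n" by auto
    have "nat (x\<^sup>2) \<le> n" using p(2) zero_le_power2[of y] by linarith
    moreover have "x \<in> A (nat (x\<^sup>2))" by (simp add: A_def)
    moreover have "y \<in> A (n - nat (x\<^sup>2))" using p(2) \<open>nat (x\<^sup>2) \<le> n\<close> by (simp add: A_def)
    ultimately show "p \<in> (\<Union>i\<in>{0..n}. A i \<times> A (n - i))"
      unfolding p by (intro UN_I[of "nat (x\<^sup>2)"]) simp_all
  qed (auto simp: A_def)
  moreover have "card (\<Union>i\<in>{0..n}. A i \<times> A (n - i)) = (\<Sum>i=0..n. card (A i \<times> A (n - i)))"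
    by (rule card_UN_disjoint) (auto simp: fin, auto simp: A_def)
  ultimately show ?thesis
    by (simp add: power2_eq_square[of phi] fps_mult_nth nth_phi_card A_def card_cartesian_product)
qed

text \<open>A number and its double have equally many representations as a sum of two squares, because
  $(u+v)^2 + (u-v)^2 = 2(u^2+v^2)$.\<close>

lemma phi_square_double: "(phi\<^sup>2) $ (2 * n) = (phi\<^sup>2) $ n"
proof -
  have "bij_betw (\<lambda>(u, v). (u + v, u - v)) {(x :: int, y :: int). x\<^sup>2 + y\<^sup>2 = int n}
      {(x, y). x\<^sup>2 + y\<^sup>2 = int (2 * n)}"
  proof (rule bij_betw_byWitness[where f' = "\<lambda>(x, y). ((x + y) div 2, (x - y) div 2)"])
    show "(\<lambda>(x, y). ((x + y) div 2, (x - y) div 2)) ` {(x :: int, y :: int). x\<^sup>2 + y\<^sup>2 = int (2 * n)}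
        \<subseteq> {(x, y). x\<^sup>2 + y\<^sup>2 = int n}"
    proof clarsimp
      fix x y :: int assume xy: "x\<^sup>2 + y\<^sup>2 = 2 * int n"
      then have "even (x\<^sup>2 + y\<^sup>2)" by simp
      then have "even (x + y)" by simp
      then obtain u where u: "x + y = 2 * u" by (elim evenE)
      then have x: "x = 2 * u - y" by simp
      have d: "(x - y) div 2 = u - y" by (simp add: x)
      have "2 * (u\<^sup>2 + (u - y)\<^sup>2) = 2 * int n"
        using xy unfolding x by (simp add: power2_eq_square algebra_simps)
      then show "((x + y) div 2)\<^sup>2 + ((x - y) div 2)\<^sup>2 = int n" by (simp add: u d)
    qed
    show "\<forall>p\<in>{(x, y). x\<^sup>2 + y\<^sup>2 = int (2 * n)}.
        (\<lambda>(u, v). (u + v, u - v)) ((\<lambda>(x, y). ((x + y) div 2, (x - y) div 2)) p) = p"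
    proof clarsimp
      fix x y :: int assume "x\<^sup>2 + y\<^sup>2 = 2 * int n"
      then have "even (x\<^sup>2 + y\<^sup>2)" by simp
      then have "even (x + y)" by simp
      then show "(x + y) div 2 + (x - y) div 2 = x \<and> (x + y) div 2 - (x - y) div 2 = y"
        by presburger
    qed
  qed (auto simp: power2_eq_square algebra_simps)
  then show ?thesis unfolding nth_phi_square by (simp only: bij_betw_same_card)
qed

lemma square_mod:
  fixes x :: nat
  shows "x\<^sup>2 mod 4 \<in> {0, 1}" "x\<^sup>2 mod 8 \<in> {0, 1, 4}" "x\<^sup>2 mod 16 \<in> {0, 1, 4, 9}"
    "x\<^sup>2 mod 32 \<in> {0, 1, 4, 9, 16, 17, 25}"
proof -
  have "\<forall>r\<in>set [0..<32]. r\<^sup>2 mod 32 \<in> {0, 1, 4, 9, 16, 17, 25 :: nat}"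
    by code_simp
  then have "(x mod 32)\<^sup>2 mod 32 \<in> {0, 1, 4, 9, 16, 17, 25}" by simp
  then show 32: "x\<^sup>2 mod 32 \<in> {0, 1, 4, 9, 16, 17, 25}" by (simp only: power_mod)
  have "x\<^sup>2 mod 4 = x\<^sup>2 mod 32 mod 4" "x\<^sup>2 mod 8 = x\<^sup>2 mod 32 mod 8" "x\<^sup>2 mod 16 = x\<^sup>2 mod 32 mod 16"
    by (simp_all add: mod_mod_cancel)
  then show "x\<^sup>2 mod 4 \<in> {0, 1}" "x\<^sup>2 mod 8 \<in> {0, 1, 4}" "x\<^sup>2 mod 16 \<in> {0, 1, 4, 9}"
    using 32 by auto
qed

lemma phi_nonzero_iff: "phi $ n \<noteq> 0 \<longleftrightarrow> (\<exists>k. n = k\<^sup>2)"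
  unfolding nth_phi by (metis zero_power2 one_neq_zero zero_neq_numeral)

lemma parity_of_half_sum:
  fixes i j m :: nat
  assumes "i mod 4 = 0 \<or> i mod 4 = 1" "j mod 4 = 0 \<or> j mod 4 = 1" "i + j = 2 * m"
  shows "even j \<longleftrightarrow> even m"
proof -
  have "2 * (m mod 2) = (i mod 4 + j mod 4) mod 4"
    using assms(3) mult_mod_right[of 2 m 2] by (simp add: mod_add_eq)
  moreover have "even j \<longleftrightarrow> j mod 4 mod 2 = 0"
    by (simp add: even_iff_mod_2_eq_zero mod_mod_cancel)
  ultimately show ?thesis
    using assms(1,2) mod2_eq_if[of m] by (elim disjE) (simp_all split: if_splits)
qed

text \<open>The product is an even function, so only the coefficients of $q^{2m}$ matter. In
  $x^2 + y^2 = 2m$ both $x$ and $y$ have the parity of $m$ (look modulo 4), so the sign is constant and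
  the doubling identity applies.\<close>

lemma phi_alt_phi: "phi * alt phi = stretch 2 ((alt phi)\<^sup>2)"
proof (rule fps_ext)
  fix n
  show "(phi * alt phi) $ n = stretch 2 ((alt phi)\<^sup>2) $ n"
  proof (cases "even n")
    case False
    have "alt (phi * alt phi) = phi * alt phi"
      by (simp add: alt_mult mult.commute)
    then have "(phi * alt phi) $ n = - (phi * alt phi) $ n"
      using False nth_alt[of "phi * alt phi" n] by simp
    then show ?thesis using False by (simp add: nth_stretch)
  next
    case True
    then obtain m where n: "n = 2 * m" by (elim evenE)
    have sign: "phi $ i * ((-1) ^ (n - i) * phi $ (n - i)) = (-1) ^ m * (phi $ i * phi $ (n - i))"
      if "i \<le> n" for i
    proof (cases "phi $ i = 0 \<or> phi $ (n - i) = 0")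
      case False
      then obtain x y where "i = x\<^sup>2" "n - i = y\<^sup>2" by (auto simp: phi_nonzero_iff)
      then have "i mod 4 = 0 \<or> i mod 4 = 1" "(n - i) mod 4 = 0 \<or> (n - i) mod 4 = 1"
        using square_mod(1) by auto
      moreover have "i + (n - i) = 2 * m" using that n by simp
      ultimately have "even (n - i) \<longleftrightarrow> even m" by (rule parity_of_half_sum)
      then show ?thesis by (simp add: minus_one_power_iff)
    qed auto
    have "(phi * alt phi) $ n = (-1) ^ m * (phi\<^sup>2) $ n"
      by (simp add: fps_mult_nth power2_eq_square[of phi] sum_distrib_left sign)
    also have "\<dots> = alt (phi\<^sup>2) $ m" by (simp only: n phi_square_double nth_alt)
    also have "\<dots> = stretch 2 ((alt phi)\<^sup>2) $ n"
      by (simp add: n nth_stretch power2_eq_square alt_mult)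
    finally show ?thesis .
  qed
qed

section \<open>The two dissections\<close>

definition sq_weighted :: "int fps" where
  "sq_weighted = q_deriv sq"

lemma nth_sq_weighted: "sq_weighted $ n = int n * sq $ n"
  by (simp add: sq_weighted_def)

text \<open>The series $(\varphi(q)^2 - 1)/4$, whose coefficient of $q^n$ is a quarter of the number of
  representations of $n$ as a sum of two squares. All reductions modulo powers of two are expansions
  in this series.\<close>

definition rho :: "int fps" where
  "rho = sq + sq\<^sup>2"

lemma phi_square: "phi\<^sup>2 = 1 + 4 * rho"
  by (simp add: phi_def rho_def power2_eq_square algebra_simps)

lemma alt_phi_square: "(alt phi)\<^sup>2 = 1 + 4 * alt rho"
proof -
  have "(alt phi)\<^sup>2 = alt (1 + 4 * rho)"
    by (simp only: phi_square[symmetric] power2_eq_square alt_mult)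
  then show ?thesis by (intro fps_ext) (simp add: algebra_simps)
qed

lemma even_sq_index: "sq $ (2 * n) = (if even n then sq $ (n div 2) else 0)"
proof -
  have "(0 < 2 * n \<and> (\<exists>k. 2 * n = k\<^sup>2)) \<longleftrightarrow> even n \<and> 0 < n div 2 \<and> (\<exists>k. n div 2 = k\<^sup>2)"
  proof (intro iffI conjI)
    assume *: "0 < 2 * n \<and> (\<exists>k. 2 * n = k\<^sup>2)"
    then obtain k where k: "2 * n = k\<^sup>2" by blast
    then have "even (k\<^sup>2)" by (metis dvd_triv_left)
    then obtain m where m: "k = 2 * m" by (auto elim: evenE)
    then have n: "n = 2 * m\<^sup>2" using k by (simp add: power2_eq_square)
    show "even n" "0 < n div 2" "\<exists>k. n div 2 = k\<^sup>2" using n * by auto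
  next
    assume *: "even n \<and> 0 < n div 2 \<and> (\<exists>k. n div 2 = k\<^sup>2)"
    then obtain k where k: "n div 2 = k\<^sup>2" by blast
    show "0 < 2 * n" using * by auto
    have "n = 2 * k\<^sup>2" using * k by (metis dvd_mult_div_cancel)
    then have "2 * n = (2 * k)\<^sup>2" by (simp add: power2_eq_square)
    then show "\<exists>k. 2 * n = k\<^sup>2" by blast
  qed
  then show ?thesis by (auto simp: nth_sq simp del: mult_pos_pos)
qed

lemma SOME_gf_phi: "stretch 2 ((alt phi)\<^sup>2) * SOME_gf = 2 * sq_weighted"
proof -
  have "stretch 2 ((alt phi)\<^sup>2) * SOME_gf = q_deriv phi"
    by (simp only: SOME_gf_eq[symmetric] phi_alt_phi mult.commute)
  also have "\<dots> = 2 * sq_weighted"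
    by (rule fps_ext) (auto simp: nth_sq_weighted phi_def)
  finally show ?thesis .
qed

definition SOME_even :: "int fps" where
  "SOME_even = even_part SOME_gf"

text \<open>Multiplying by $\varphi(q)^2$ makes the denominator a series in $q^2$, which prepares the second
  dissection.\<close>

lemma SOME_even_phi:
  "stretch 2 ((alt phi) ^ 4) * SOME_even = stretch 2 (8 * sq_weighted) * phi\<^sup>2"
proof -
  have 1: "(alt phi)\<^sup>2 * SOME_even = even_part (2 * sq_weighted)"
    unfolding SOME_even_def SOME_gf_phi[symmetric] by (rule even_part_stretch_mult[symmetric])
  have 2: "even_part (2 * sq_weighted) = stretch 2 (8 * sq_weighted)"
  proof (rule fps_ext)
    fix n
    show "even_part (2 * sq_weighted) $ n = stretch 2 (8 * sq_weighted) $ n"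
      by (cases "even n") (auto simp: nth_stretch nth_sq_weighted even_sq_index elim!: evenE)
  qed
  have "stretch 2 ((alt phi) ^ 4) = (phi * alt phi)\<^sup>2"
    unfolding phi_alt_phi power2_eq_square[of "stretch _ _"]
    by (subst stretch_mult[symmetric]) (simp_all flip: power_add)
  then have "stretch 2 ((alt phi) ^ 4) * SOME_even = ((alt phi)\<^sup>2 * SOME_even) * phi\<^sup>2"
    by (simp only: power_mult_distrib ac_simps)
  then show ?thesis by (simp only: 1 2)
qed

text \<open>The generating functions of the values at the arguments $4n$ and $4n+2$.\<close>

definition SOME_0 :: "int fps" where
  "SOME_0 = even_part SOME_even"

definition SOME_2 :: "int fps" where
  "SOME_2 = odd_part SOME_even"

lemma nth_SOME_0: "SOME_0 $ n = SOME_bar (4 * n)"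
  by (simp add: SOME_0_def SOME_even_def SOME_gf_def)

lemma nth_SOME_2: "SOME_2 $ n = SOME_bar (4 * n + 2)"
  by (simp add: SOME_2_def SOME_even_def SOME_gf_def)

lemma SOME_0_phi: "(alt phi) ^ 4 * SOME_0 = 8 * sq_weighted * phi\<^sup>2"
proof -
  have "even_part (phi\<^sup>2) = phi\<^sup>2"
    by (rule fps_ext) (simp only: nth_even_part phi_square_double)
  then show ?thesis
    using even_part_stretch_mult[of "(alt phi) ^ 4" SOME_even]
      even_part_stretch_mult[of "8 * sq_weighted" "phi\<^sup>2"]
    by (simp only: SOME_0_def SOME_even_phi)
qed

lemma SOME_2_phi: "(alt phi) ^ 4 * SOME_2 = 32 * (sq_weighted * odd_part rho)"
proof -
  have "odd_part (phi\<^sup>2) = 4 * odd_part rho"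
    unfolding phi_square by (rule fps_ext) simp
  then have "(alt phi) ^ 4 * SOME_2 = 8 * sq_weighted * (4 * odd_part rho)"
    using odd_part_stretch_mult[of "(alt phi) ^ 4" SOME_even]
      odd_part_stretch_mult[of "8 * sq_weighted" "phi\<^sup>2"]
    by (simp only: SOME_2_def SOME_even_phi)
  then show ?thesis by (simp add: algebra_simps)
qed

section \<open>Reduction modulo powers of two\<close>

text \<open>Since $\varphi(-q)^4 \equiv 1$ modulo 8, dividing by it changes nothing modulo 8; the factor 32
  on the other side lifts this to a congruence modulo 256.\<close>

lemma SOME_2_cong: "\<exists>r. SOME_2 = 32 * (sq_weighted * odd_part rho) + 256 * r"
proof -
  define y where "y = alt rho + 2 * (alt rho)\<^sup>2"
  have "(alt phi) ^ 4 = ((alt phi)\<^sup>2)\<^sup>2" by (simp flip: power_mult)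
  also have "\<dots> = 1 + 8 * y"
    unfolding alt_phi_square y_def by (simp add: power2_eq_square algebra_simps)
  finally have "(1 + 8 * y) * SOME_2 = 32 * (sq_weighted * odd_part rho)"
    using SOME_2_phi by simp
  then have S: "SOME_2 = 32 * (sq_weighted * odd_part rho) - 8 * (y * SOME_2)"
    by (simp add: algebra_simps)
  \<comment> \<open>Two rounds of substitution improve divisibility of the error from 8 to 64 and then to 256.\<close>
  define G where "G = 4 * (sq_weighted * odd_part rho) - y * SOME_2"
  have G: "SOME_2 = 8 * G" using S by (simp add: G_def algebra_simps)
  define H where "H = sq_weighted * odd_part rho - 2 * (y * G)"
  have "G = 4 * (sq_weighted * odd_part rho) - y * (8 * G)"
    using G_def by (simp only: G)
  then have "SOME_2 = 8 * (4 * (sq_weighted * odd_part rho) - y * (8 * G))"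
    using G by (simp only:)
  then have H: "SOME_2 = 32 * H"
    by (simp add: H_def algebra_simps)
  have "SOME_2 = 32 * (sq_weighted * odd_part rho) + 256 * (- (y * H))"
    using S unfolding H by (simp add: algebra_simps)
  then show ?thesis by blast
qed

text \<open>This is $(\varphi(-q^2)^2 - 1)/4$. It contains even powers of $q$ only.\<close>

definition sigma :: "int fps" where
  "sigma = stretch 2 (alt rho)"

text \<open>Multiplying the equation for the arguments $4n$ by $\varphi(q)^4$ turns it into
  $(1 + 4\sigma)^4\, S = 8 Z (1 + 4\rho)^3$, with $Z = \sum_k k^2 q^{k^2}$. Modulo 64 the inverse of
  $(1 + 4\sigma)^4$ is $1 - 16\sigma + 32\sigma^2$.\<close>

lemma SOME_0_cong_512:
  "\<exists>r. SOME_0 = 8 * (sq_weighted * (1 + 12 * rho + 48 * rho\<^sup>2 - 16 * sigma + 32 * sigma\<^sup>2))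
     + 512 * r"
proof -
  let ?Z = sq_weighted
  have c: "stretch 2 (4 * f) = 4 * stretch 2 f" for f
    by (rule fps_ext) (simp add: nth_stretch)
  have "(phi * alt phi) ^ 4 = (1 + 4 * sigma) ^ 4"
    unfolding phi_alt_phi alt_phi_square sigma_def by (simp add: stretch_add c)
  moreover have "(phi * alt phi) ^ 4 * SOME_0 = phi ^ 4 * ((alt phi) ^ 4 * SOME_0)"
    by (simp only: power_mult_distrib ac_simps)
  moreover have "phi ^ 4 * (8 * ?Z * phi\<^sup>2) = 8 * ?Z * (phi\<^sup>2) ^ 3"
    by (simp add: eval_nat_numeral algebra_simps)
  ultimately have key: "(1 + 4 * sigma) ^ 4 * SOME_0 = 8 * (?Z * (1 + 4 * rho) ^ 3)"
    by (simp only: SOME_0_phi phi_square mult.assoc)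
  \<comment> \<open>The series y and w collect everything that is divisible by 64 in the two products below.\<close>
  define I where "I = 1 - 16 * sigma + 32 * sigma\<^sup>2"
  define y where "y = - 2 * sigma\<^sup>2 - 12 * sigma ^ 3 - 12 * sigma ^ 4 + 64 * sigma ^ 5 + 128 * sigma ^ 6"
  define w where "w = - 3 * (rho * sigma) + 6 * (rho * sigma\<^sup>2) - 12 * (rho\<^sup>2 * sigma)
    + 24 * (rho\<^sup>2 * sigma\<^sup>2) + rho ^ 3 * I"
  have I: "I * (1 + 4 * sigma) ^ 4 = 1 + 64 * y"
    unfolding I_def y_def by (simp add: eval_nat_numeral algebra_simps)
  have w: "(1 + 4 * rho) ^ 3 * I = 1 + 12 * rho + 48 * rho\<^sup>2 - 16 * sigma + 32 * sigma\<^sup>2 + 64 * w"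
    unfolding w_def I_def by (simp add: eval_nat_numeral algebra_simps)
  have "I * ((1 + 4 * sigma) ^ 4 * SOME_0) = (1 + 64 * y) * SOME_0"
    by (simp only: I[symmetric] mult.assoc)
  then have S: "SOME_0 = 8 * (?Z * ((1 + 4 * rho) ^ 3 * I)) - 64 * (y * SOME_0)"
    unfolding key by (simp add: algebra_simps)
  define G where "G = ?Z * ((1 + 4 * rho) ^ 3 * I) - 8 * (y * SOME_0)"
  have G: "SOME_0 = 8 * G" using S by (simp add: G_def algebra_simps)
  have "SOME_0 = 8 * (?Z * (1 + 12 * rho + 48 * rho\<^sup>2 - 16 * sigma + 32 * sigma\<^sup>2))
      + 512 * (?Z * w - y * G)"
    using S unfolding w G by (simp add: algebra_simps)
  then show ?thesis by blast
qed

lemma numeral_dvd_fps_iff: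
  "numeral k dvd (f :: int fps) \<longleftrightarrow> (\<forall>n. numeral k dvd f $ n)"
proof
  assume *: "\<forall>n. numeral k dvd f $ n"
  have "f = numeral k * Abs_fps (\<lambda>n. f $ n div numeral k)"
    by (rule fps_ext) (simp add: *)
  then show "numeral k dvd f" by (metis dvd_triv_left)
qed (auto elim!: dvdE)

text \<open>Terms that are exchanged by the reflection cancel modulo 2; only the middle one is left.\<close>

lemma symmetric_sum_parity:
  fixes g :: "nat \<Rightarrow> int"
  assumes "\<And>i. i \<le> n \<Longrightarrow> g i = g (n - i)"
  shows "2 dvd (\<Sum>i=0..n. g i) - (if even n then g (n div 2) else 0)"
  using assms
proof (induction n arbitrary: g rule: less_induct)
  case (less n)
  consider "n = 0" | "n = 1" | m where "n = m + 2"
    by (metis One_nat_def add_2_eq_Suc' not0_implies_Suc)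
  then show ?case
  proof cases
    case 2
    then have "g 0 = g 1" using less.prems[of 0] by simp
    then show ?thesis using 2 by simp
  next
    case (3 m)
    have mn: "m < n" using 3 by simp
    have sym: "g (Suc i) = g (Suc (m - i))" if "i \<le> m" for i
      using less.prems[of "Suc i"] that 3 by (simp add: Suc_diff_le)
    have IH: "2 dvd (\<Sum>i=0..m. g (Suc i)) - (if even m then g (Suc (m div 2)) else 0)"
      by (rule less.IH[of m "\<lambda>i. g (Suc i)", OF mn sym])
    have "(\<Sum>i=0..n. g i) = g 0 + g n + (\<Sum>i=0..m. g (Suc i))"
      unfolding 3 add_2_eq_Suc' sum.atLeast0_atMost_Suc_shift[of _ "Suc m"]
      by (simp add: sum.atLeast0_atMost_Suc)
    moreover have "g 0 = g n" using less.prems[of 0] by simp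
    ultimately have "(\<Sum>i=0..n. g i) - (if even n then g (n div 2) else 0)
        = 2 * g n + ((\<Sum>i=0..m. g (Suc i)) - (if even m then g (Suc (m div 2)) else 0))"
      using 3 by simp
    then show ?thesis using IH by (simp only: dvd_add dvd_triv_left)
  qed simp
qed

text \<open>Squaring is the Frobenius map modulo 2: $f(q)^2 \equiv f(q^2)$.\<close>

lemma frobenius: "2 dvd f\<^sup>2 - stretch 2 f"
  unfolding numeral_dvd_fps_iff
proof
  fix n
  have 1: "2 dvd (f\<^sup>2) $ n - (if even n then f $ (n div 2) * f $ (n - n div 2) else 0)"
    unfolding power2_eq_square fps_mult_nth by (rule symmetric_sum_parity) simp
  have 2: "2 dvd (if even n then f $ (n div 2) * f $ (n - n div 2) else 0) - stretch 2 f $ n"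
    by (auto simp: nth_stretch elim!: evenE)
  show "2 dvd (f\<^sup>2 - stretch 2 f) $ n"
    using dvd_add[OF 1 2] by simp
qed

text \<open>By the Frobenius congruence $\sigma \equiv \rho(q^2) \equiv \rho^2$ modulo 2, so that
  $48\rho^2 - 16\sigma$ vanishes modulo 32.\<close>

lemma SOME_0_cong_256:
  "\<exists>r. SOME_0 = 8 * (sq_weighted * (1 + 12 * rho)) + 256 * r"
proof -
  obtain r where r: "SOME_0 =
      8 * (sq_weighted * (1 + 12 * rho + 48 * rho\<^sup>2 - 16 * sigma + 32 * sigma\<^sup>2)) + 512 * r"
    using SOME_0_cong_512 by (rule exE)
  obtain h where h: "rho\<^sup>2 - stretch 2 rho = 2 * h" using frobenius[of rho] by (elim dvdE)
  have "2 dvd sigma - stretch 2 rho"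
    unfolding numeral_dvd_fps_iff sigma_def by (auto simp: nth_stretch minus_one_power_iff)
  then obtain h' where h': "sigma - stretch 2 rho = 2 * h'" by (elim dvdE)
  have sigma_eq: "sigma = rho\<^sup>2 - 2 * h + 2 * h'"
    using h h' by (simp add: algebra_simps)
  have e: "48 * rho\<^sup>2 - 16 * sigma + 32 * sigma\<^sup>2 = 32 * (rho\<^sup>2 + h - h' + sigma\<^sup>2)"
    by (subst (1) sigma_eq) (simp add: algebra_simps)
  have "SOME_0 = 8 * (sq_weighted * (1 + 12 * rho))
      + 8 * (sq_weighted * (48 * rho\<^sup>2 - 16 * sigma + 32 * sigma\<^sup>2)) + 512 * r"
    unfolding r by (simp add: algebra_simps)
  also have "\<dots> = 8 * (sq_weighted * (1 + 12 * rho))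
      + 256 * (sq_weighted * (rho\<^sup>2 + h - h' + sigma\<^sup>2) + 2 * r)"
    unfolding e by (simp add: algebra_simps)
  finally show ?thesis by blast
qed

section \<open>Residues of squares and divisibility of coefficients\<close>

lemma dvd_nth_mult:
  fixes f g :: "int fps"
  assumes "\<And>i j. i + j = n \<Longrightarrow> f $ i \<noteq> 0 \<Longrightarrow> g $ j \<noteq> 0 \<Longrightarrow> d dvd f $ i * g $ j"
  shows "d dvd (f * g) $ n"
  unfolding fps_mult_nth
proof (rule dvd_sum)
  fix i assume "i \<in> {0..n}"
  then show "d dvd f $ i * g $ (n - i)"
    using assms[of i "n - i"] by (cases "f $ i = 0 \<or> g $ (n - i) = 0") auto
qed

lemma nth_mult_nonzero:
  fixes f g :: "int fps"
  assumes "(f * g) $ n \<noteq> 0"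
  obtains i j where "i + j = n" "f $ i \<noteq> 0" "g $ j \<noteq> 0"
proof -
  have "\<not> (0 dvd (f * g) $ n)" using assms by simp
  then show ?thesis using dvd_nth_mult[of n f g 0] that by blast
qed

text \<open>From here on only residues of squares matter. A nonzero contribution to the coefficient of
  $q^n$ in $Z\rho$ comes from a representation $n = x^2 + y^2 + z^2$ and carries the factor $x^2$.\<close>

lemma sq_nonzero:
  assumes "sq $ n \<noteq> 0"
  obtains x where "n = x\<^sup>2"
  using assms by (auto simp: nth_sq)

lemma sq_weighted_nonzero:
  assumes "sq_weighted $ n \<noteq> 0"
  obtains x where "n = x\<^sup>2"
  using assms by (auto simp: nth_sq_weighted elim: sq_nonzero)

lemma sq_square_nonzero:
  assumes "(sq\<^sup>2) $ n \<noteq> 0"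
  obtains x y where "n = x\<^sup>2 + y\<^sup>2"
  using assms unfolding power2_eq_square[of sq] by (metis nth_mult_nonzero sq_nonzero)

lemma rho_nonzero:
  assumes "rho $ n \<noteq> 0"
  obtains x y where "n = x\<^sup>2 + y\<^sup>2"
proof (cases "sq $ n = 0")
  case True
  then have "(sq\<^sup>2) $ n \<noteq> 0" using assms by (simp add: rho_def)
  then show ?thesis using that by (rule sq_square_nonzero)
next
  case False
  then obtain x where "n = x\<^sup>2 + 0\<^sup>2" by (auto elim: sq_nonzero)
  then show ?thesis by (rule that)
qed

lemma dvd_sq_weighted:
  "numeral k dvd n \<Longrightarrow> numeral k dvd sq_weighted $ n"
  "numeral k dvd n \<Longrightarrow> numeral k dvd sq_weighted $ n * c"
  by (auto simp: nth_sq_weighted elim!: dvdE)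

lemma sq_weighted_index:
  assumes "sq_weighted $ i \<noteq> 0"
  shows "4 dvd i \<or> i mod 8 = 1" "8 dvd i \<or> i mod 8 = 1 \<or> i mod 8 = 4"
proof -
  obtain x where "i = x\<^sup>2" using assms by (rule sq_weighted_nonzero)
  then have "i mod 8 = 0 \<or> i mod 8 = 1 \<or> i mod 8 = 4" using square_mod(2)[of x] by simp
  then show "8 dvd i \<or> i mod 8 = 1 \<or> i mod 8 = 4" "4 dvd i \<or> i mod 8 = 1" by presburger+
qed

lemma complement_mod:
  fixes i j m n :: nat
  assumes "i + j = n" "i mod m = a" "n mod m = (a + b) mod m" "b < m"
  shows "j mod m = b"
proof -
  have "[a + j = a + b] (mod m)"
    using assms(2,3) unfolding assms(1)[symmetric] cong_def by (metis mod_add_left_eq)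
  then have "[j = b] (mod m)" by (simp only: cong_add_lcancel_nat)
  then show ?thesis using assms(4) by (simp add: cong_def)
qed

text \<open>Such an $n$ is not a square, and it is odd, so the Frobenius congruence makes the number of
  its representations as an ordered sum of two positive squares even.\<close>

lemma rho_even_5_mod_8:
  assumes "n mod 8 = 5"
  shows "2 dvd rho $ n"
proof -
  have "sq $ n = 0"
  proof (rule ccontr)
    assume "sq $ n \<noteq> 0"
    then obtain x where "n = x\<^sup>2" by (rule sq_nonzero)
    then show False using square_mod(2)[of x] assms by auto
  qed
  moreover have "odd n" using assms by presburger
  then have "2 dvd (sq\<^sup>2) $ n"
    using frobenius[of sq] unfolding numeral_dvd_fps_iff by (auto simp: nth_stretch dest: spec[of _ n])
  ultimately show ?thesis by (simp add: rho_def)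
qed

text \<open>Here the Frobenius congruence reduces the parity to the question whether $n/2$, which is 10
  modulo 16, is a square.\<close>

lemma rho_even_20_mod_32:
  assumes "n mod 32 = 20"
  shows "2 dvd rho $ n"
proof -
  have nonsq: "sq $ k = 0" if "k mod 16 = 10 \<or> k mod 32 = 20" for k
  proof (rule ccontr)
    assume "sq $ k \<noteq> 0"
    then obtain x where "k = x\<^sup>2" by (rule sq_nonzero)
    then show False using square_mod(3,4)[of x] that by auto
  qed
  define q where "q = n div 32"
  have n: "n = 2 * (16 * q + 10)"
    using div_mult_mod_eq[of n 32] assms by (simp add: q_def)
  have "2 dvd (sq\<^sup>2 - stretch 2 sq) $ n"
    using frobenius[of sq] unfolding numeral_dvd_fps_iff by (rule spec)
  moreover have "stretch 2 sq $ n = sq $ (16 * q + 10)"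
    unfolding n by (subst nth_stretch) simp_all
  moreover have "sq $ (16 * q + 10) = 0" by (rule nonsq) simp
  moreover have "sq $ n = 0" using assms by (intro nonsq) simp
  ultimately show ?thesis by (simp add: rho_def)
qed

lemma sq_weighted_times_rho_nonzero:
  assumes "i + j = n" "sq_weighted $ i \<noteq> 0" "rho $ j \<noteq> 0"
  obtains x y z where "i = x\<^sup>2" "j = y\<^sup>2 + z\<^sup>2" "n = x\<^sup>2 + y\<^sup>2 + z\<^sup>2"
  using assms by (elim sq_weighted_nonzero rho_nonzero) auto

lemma three_squares_mod_8: "((x::nat)\<^sup>2 + y\<^sup>2 + z\<^sup>2) mod 8 \<noteq> 7"
proof -
  have "(x\<^sup>2 + y\<^sup>2 + z\<^sup>2) mod 8 = (x\<^sup>2 mod 8 + y\<^sup>2 mod 8 + z\<^sup>2 mod 8) mod 8"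
    by (intro mod_add_cong) simp_all
  then show ?thesis using square_mod(2)[of x] square_mod(2)[of y] square_mod(2)[of z] by auto
qed

lemma three_squares_dvd_4:
  assumes "4 dvd (x::nat)\<^sup>2 + y\<^sup>2 + z\<^sup>2"
  shows "4 dvd x\<^sup>2" "4 dvd y\<^sup>2" "4 dvd z\<^sup>2"
proof -
  have "(x\<^sup>2 + y\<^sup>2 + z\<^sup>2) mod 4 = (x\<^sup>2 mod 4 + y\<^sup>2 mod 4 + z\<^sup>2 mod 4) mod 4"
    by (intro mod_add_cong) simp_all
  then have "(x\<^sup>2 mod 4 + y\<^sup>2 mod 4 + z\<^sup>2 mod 4) mod 4 = 0"
    using assms by (simp only: dvd_eq_mod_eq_0)
  then show "4 dvd x\<^sup>2" "4 dvd y\<^sup>2" "4 dvd z\<^sup>2"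
    using square_mod(1)[of x] square_mod(1)[of y] square_mod(1)[of z]
    unfolding dvd_eq_mod_eq_0 by (elim insertE emptyE; simp)+
qed

lemma three_squares_mod_4:
  assumes "4 dvd (x::nat)\<^sup>2 + y\<^sup>2 + z\<^sup>2"
  obtains a b c where "x = 2 * a" "y = 2 * b" "z = 2 * c"
  using three_squares_dvd_4[OF assms] 
  by (metis (no_types, opaque_lifting) dvd_def dvd_trans even_numeral even_power)

lemma three_squares_mod_32: "((x::nat)\<^sup>2 + y\<^sup>2 + z\<^sup>2) mod 32 \<noteq> 28"
proof
  assume *: "(x\<^sup>2 + y\<^sup>2 + z\<^sup>2) mod 32 = 28"
  then have "4 dvd x\<^sup>2 + y\<^sup>2 + z\<^sup>2"
    by (intro dvd_mod_imp_dvd[of 4 "x\<^sup>2 + y\<^sup>2 + z\<^sup>2" 32]) simp_all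
  then obtain a b c where "x = 2 * a" "y = 2 * b" "z = 2 * c" by (rule three_squares_mod_4)
  then have "x\<^sup>2 + y\<^sup>2 + z\<^sup>2 = 4 * (a\<^sup>2 + b\<^sup>2 + c\<^sup>2)" by (simp add: power2_eq_square)
  then have "(a\<^sup>2 + b\<^sup>2 + c\<^sup>2) mod 8 = 7"
    using * mult_mod_right[of 4 "a\<^sup>2 + b\<^sup>2 + c\<^sup>2" 8] by simp
  then show False using three_squares_mod_8 by blast
qed

lemma three_squares_dvd_16:
  assumes "16 dvd (x::nat)\<^sup>2 + y\<^sup>2 + z\<^sup>2"
  shows "16 dvd x\<^sup>2"
proof -
  have 4: "4 dvd x\<^sup>2 + y\<^sup>2 + z\<^sup>2"
    using assms by (rule dvd_trans[rotated]) simp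
  obtain a b c where abc: "x = 2 * a" "y = 2 * b" "z = 2 * c"
    using three_squares_mod_4[OF 4] by blast
  then have "x\<^sup>2 + y\<^sup>2 + z\<^sup>2 = 4 * (a\<^sup>2 + b\<^sup>2 + c\<^sup>2)" by (simp add: power2_eq_square)
  then have "4 * 4 dvd 4 * (a\<^sup>2 + b\<^sup>2 + c\<^sup>2)" using assms by simp
  then have "4 dvd a\<^sup>2 + b\<^sup>2 + c\<^sup>2" by (simp only: nat_mult_dvd_cancel1 zero_less_numeral)
  then have "4 dvd a\<^sup>2" by (rule three_squares_dvd_4)
  then have "4 * 4 dvd 4 * a\<^sup>2" by (intro mult_dvd_mono) simp_all
  then show ?thesis by (simp add: abc power2_eq_square)
qed

lemma sq_weighted_rho_eq_0:
  assumes "n mod 8 = 7 \<or> n mod 32 = 28"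
  shows "(sq_weighted * rho) $ n = 0"
proof -
  have "0 dvd (sq_weighted * rho) $ n"
  proof (rule dvd_nth_mult)
    fix i j assume "i + j = n" "sq_weighted $ i \<noteq> 0" "rho $ j \<noteq> 0"
    then obtain x y z where "n = x\<^sup>2 + y\<^sup>2 + z\<^sup>2" by (rule sq_weighted_times_rho_nonzero)
    then show "0 dvd sq_weighted $ i * rho $ j"
      using assms three_squares_mod_8[of x y z] three_squares_mod_32[of x y z] by auto
  qed
  then show ?thesis by simp
qed

lemma sq_weighted_rho_dvd_4:
  assumes "4 dvd n"
  shows "4 dvd (sq_weighted * rho) $ n"
proof (rule dvd_nth_mult)
  fix i j assume "i + j = n" "sq_weighted $ i \<noteq> 0" "rho $ j \<noteq> 0"
  then obtain x y z where "i = x\<^sup>2" "n = x\<^sup>2 + y\<^sup>2 + z\<^sup>2" by (rule sq_weighted_times_rho_nonzero)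
  then have "4 dvd i" using assms three_squares_dvd_4(1) by blast
  then show "4 dvd sq_weighted $ i * rho $ j" by (rule dvd_sq_weighted(2))
qed

lemma sq_weighted_rho_dvd_16:
  assumes "16 dvd n"
  shows "16 dvd (sq_weighted * rho) $ n"
proof (rule dvd_nth_mult)
  fix i j assume "i + j = n" "sq_weighted $ i \<noteq> 0" "rho $ j \<noteq> 0"
  then obtain x y z where "i = x\<^sup>2" "n = x\<^sup>2 + y\<^sup>2 + z\<^sup>2" by (rule sq_weighted_times_rho_nonzero)
  then have "16 dvd i" using assms three_squares_dvd_16 by blast
  then show "16 dvd sq_weighted $ i * rho $ j" by (rule dvd_sq_weighted(2))
qed

lemma sq_weighted_rho_mod_8_6:
  assumes "n mod 8 = 6"
  shows "2 dvd (sq_weighted * rho) $ n"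
proof (rule dvd_nth_mult)
  fix i j assume n: "i + j = n" and "sq_weighted $ i \<noteq> 0"
  then consider "4 dvd i" | "i mod 8 = 1" using sq_weighted_index(1) by blast
  then show "2 dvd sq_weighted $ i * rho $ j"
  proof cases
    case 1
    then have "2 dvd i" by presburger
    then show ?thesis by (rule dvd_sq_weighted(2))
  next
    case 2
    then have "j mod 8 = 5" using assms by (intro complement_mod[OF n, of 8 1]) simp_all
    then show ?thesis using rho_even_5_mod_8 by simp
  qed
qed

text \<open>As $n$ is divisible by 4, so are all three squares. If the weighted one is not divisible by 8, it is
  4 modulo 32, and the other two sum to 20 modulo 32, which happens in an even number of ways.\<close>

lemma sq_weighted_rho_mod_32_24:
  assumes "n mod 32 = 24"
  shows "8 dvd (sq_weighted * rho) $ n"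
proof (rule dvd_nth_mult)
  fix i j assume n: "i + j = n" and nz: "sq_weighted $ i \<noteq> 0" "rho $ j \<noteq> 0"
  then obtain x y z where i: "i = x\<^sup>2" and xyz: "n = x\<^sup>2 + y\<^sup>2 + z\<^sup>2"
    by (rule sq_weighted_times_rho_nonzero)
  have "4 dvd n" using assms by presburger
  then have "4 dvd i" using three_squares_dvd_4(1) i xyz by blast
  then have "4 dvd i mod 32" by (simp add: dvd_mod)
  moreover have "i mod 32 \<in> {0, 1, 4, 9, 16, 17, 25}" unfolding i by (rule square_mod(4))
  ultimately have "i mod 32 = 4 \<or> 8 dvd i mod 32" by auto
  then consider "8 dvd i" | "i mod 32 = 4"
    using dvd_mod_imp_dvd[of 8 i 32] by auto
  then show "8 dvd sq_weighted $ i * rho $ j"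
  proof cases
    case 1
    then show ?thesis by (rule dvd_sq_weighted(2))
  next
    case 2
    then have "j mod 32 = 20" using assms by (intro complement_mod[OF n, of 32 4]) simp_all
    then have "2 dvd rho $ j" by (rule rho_even_20_mod_32)
    moreover have "4 dvd sq_weighted $ i" using \<open>4 dvd i\<close> by (rule dvd_sq_weighted(1))
    ultimately have "4 * 2 dvd sq_weighted $ i * rho $ j" by (intro mult_dvd_mono)
    then show ?thesis by simp
  qed
qed

text \<open>If $f^2 = f(q^2) + 2h$, then $f^4 \equiv f(q^2)^2$ modulo 4, and the right-hand side is an even
  function.\<close>

lemma sq_power4_odd:
  assumes "odd n"
  shows "4 dvd (sq ^ 4) $ n"
proof -
  obtain h where "sq\<^sup>2 - stretch 2 sq = 2 * h" using frobenius[of sq] by (elim dvdE)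
  then have h: "sq\<^sup>2 = stretch 2 sq + 2 * h" by (simp add: algebra_simps)
  have "sq ^ 4 = (sq\<^sup>2)\<^sup>2" by (simp flip: power_mult)
  also have "\<dots> = stretch 2 (sq\<^sup>2) + 4 * (stretch 2 sq * h + h\<^sup>2)"
    unfolding power2_eq_square[of sq] stretch_mult[OF zero_less_numeral]
    by (simp add: h[unfolded power2_eq_square] power2_eq_square algebra_simps)
  finally show ?thesis using assms by (simp add: nth_stretch)
qed

text \<open>Expanding the square of $a + a^2$, where $a = \sum_{k \ge 1} q^{k^2}$, the terms $a^2$ and $a^3$
  do not contribute, as numbers that are 7 modulo 8 are not sums of three squares. The term $a^4$ has odd
  coefficients divisible by 4.\<close>

lemma rho_square_mod_8_7:
  assumes "n mod 8 = 7"
  shows "4 dvd (rho\<^sup>2) $ n"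
proof -
  have "(sq\<^sup>2) $ n = 0"
  proof (rule ccontr)
    assume "(sq\<^sup>2) $ n \<noteq> 0"
    then obtain x y where "n = x\<^sup>2 + y\<^sup>2 + 0\<^sup>2" by (auto elim: sq_square_nonzero)
    then show False using assms three_squares_mod_8 by metis
  qed
  moreover have "(sq * sq\<^sup>2) $ n = 0"
  proof (rule ccontr)
    assume "(sq * sq\<^sup>2) $ n \<noteq> 0"
    then obtain i j where "i + j = n" "sq $ i \<noteq> 0" "(sq\<^sup>2) $ j \<noteq> 0" by (rule nth_mult_nonzero)
    then obtain x y z where "n = x\<^sup>2 + y\<^sup>2 + z\<^sup>2"
      by (metis sq_nonzero sq_square_nonzero add.assoc)
    then show False using assms three_squares_mod_8 by metis
  qed
  moreover have "rho\<^sup>2 = sq\<^sup>2 + 2 * (sq * sq\<^sup>2) + sq ^ 4"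
    by (simp add: rho_def eval_nat_numeral algebra_simps)
  moreover have "odd n" using assms by presburger
  ultimately show ?thesis using sq_power4_odd[of n] by simp
qed

text \<open>For even cofactors the weighted square has to be even, and then it is divisible by 4.\<close>

lemma sq_weighted_times_even_dvd_4:
  assumes "4 dvd n" "\<And>j. odd j \<Longrightarrow> f $ j = 0"
  shows "4 dvd (sq_weighted * f) $ n"
proof (rule dvd_nth_mult)
  fix i j assume n: "i + j = n" and nz: "sq_weighted $ i \<noteq> 0" "f $ j \<noteq> 0"
  then have "4 dvd i \<or> i mod 8 = 1" using sq_weighted_index(1) by blast
  moreover have "even j" using assms(2) nz(2) by blast
  ultimately have "4 dvd i" using n assms(1) by presburger
  then show "4 dvd sq_weighted $ i * f $ j" by (rule dvd_sq_weighted(2))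
qed

lemma sq_weighted_rho_square_dvd_4:
  assumes "8 dvd n"
  shows "4 dvd (sq_weighted * rho\<^sup>2) $ n"
proof (rule dvd_nth_mult)
  fix i j assume n: "i + j = n" and nz: "sq_weighted $ i \<noteq> 0"
  then consider "4 dvd i" | "i mod 8 = 1" using sq_weighted_index(1) by blast
  then show "4 dvd sq_weighted $ i * (rho\<^sup>2) $ j"
  proof cases
    case 1
    then show ?thesis by (rule dvd_sq_weighted(2))
  next
    case 2
    then have "j mod 8 = 7" using assms by (intro complement_mod[OF n, of 8 1]) simp_all
    then show ?thesis using rho_square_mod_8_7 by simp
  qed
qed

lemma sq_weighted_nonsquare: "(\<And>x. n \<noteq> x\<^sup>2) \<Longrightarrow> sq_weighted $ n = 0"
  by (metis sq_weighted_nonzero)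

lemma SOME_0_256:
  assumes "\<And>x. n \<noteq> x\<^sup>2"
  shows "\<exists>r. SOME_bar (4 * n) = 96 * (sq_weighted * rho) $ n + 256 * r"
proof -
  obtain r where r: "SOME_0 = 8 * (sq_weighted * (1 + 12 * rho)) + 256 * r"
    using SOME_0_cong_256 by (rule exE)
  have e: "8 * (sq_weighted * (1 + 12 * rho)) = 8 * sq_weighted + 96 * (sq_weighted * rho)"
    by (simp add: algebra_simps)
  have "SOME_bar (4 * n) = (8 * sq_weighted + 96 * (sq_weighted * rho) + 256 * r) $ n"
    by (simp only: nth_SOME_0[symmetric] r e)
  then have "SOME_bar (4 * n) = 96 * (sq_weighted * rho) $ n + 256 * r $ n"
    by (simp add: sq_weighted_nonsquare[OF assms])
  then show ?thesis by blast
qed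

text \<open>Each of the five terms is dealt with separately. The nonsquare hypothesis kills the first one;
  in the others divisibility of the weighted square, or of its cofactor, makes up for the missing
  power of two.\<close>

lemma SOME_0_512:
  assumes "\<And>x. n \<noteq> x\<^sup>2" "16 dvd n"
  shows "512 dvd SOME_bar (4 * n)"
proof -
  let ?Z = sq_weighted
  obtain r where r: "SOME_0 =
      8 * (?Z * (1 + 12 * rho + 48 * rho\<^sup>2 - 16 * sigma + 32 * sigma\<^sup>2)) + 512 * r"
    using SOME_0_cong_512 by (rule exE)
  have e: "8 * (?Z * (1 + 12 * rho + 48 * rho\<^sup>2 - 16 * sigma + 32 * sigma\<^sup>2))
      = 8 * ?Z + 96 * (?Z * rho) + 384 * (?Z * rho\<^sup>2) - 128 * (?Z * sigma) + 256 * (?Z * sigma\<^sup>2)"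
    by (simp add: algebra_simps)
  have "SOME_bar (4 * n) = (8 * ?Z + 96 * (?Z * rho) + 384 * (?Z * rho\<^sup>2) - 128 * (?Z * sigma)
      + 256 * (?Z * sigma\<^sup>2) + 512 * r) $ n"
    by (simp only: nth_SOME_0[symmetric] r e)
  then have S: "SOME_bar (4 * n) = 96 * (?Z * rho) $ n + 384 * (?Z * rho\<^sup>2) $ n - 128 * (?Z * sigma) $ n
      + 256 * (?Z * sigma\<^sup>2) $ n + 512 * r $ n"
    by (simp add: sq_weighted_nonsquare[OF assms(1)])
  have div: "8 dvd n" "4 dvd n" using assms(2) by presburger+
  have v2: "sigma\<^sup>2 = stretch 2 ((alt rho)\<^sup>2)" by (simp add: sigma_def power2_eq_square stretch_mult)
  obtain a where a: "(?Z * rho) $ n = 16 * a"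
    using sq_weighted_rho_dvd_16[OF assms(2)] by (elim dvdE)
  obtain b where b: "(?Z * rho\<^sup>2) $ n = 4 * b"
    using sq_weighted_rho_square_dvd_4[OF div(1)] by (elim dvdE)
  have "4 dvd (?Z * sigma) $ n"
    using div(2) by (rule sq_weighted_times_even_dvd_4) (simp add: sigma_def nth_stretch)
  then obtain c where c: "(?Z * sigma) $ n = 4 * c" by (elim dvdE)
  have "4 dvd (?Z * sigma\<^sup>2) $ n"
    using div(2) by (rule sq_weighted_times_even_dvd_4) (simp add: v2 nth_stretch)
  then obtain d where d: "(?Z * sigma\<^sup>2) $ n = 4 * d" by (elim dvdE)
  have "SOME_bar (4 * n) = 512 * (3 * a + 3 * b - c + 2 * d + r $ n)"
    unfolding S a b c d by simp
  then show ?thesis by (metis dvd_triv_left)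
qed

lemma SOME_2_256: "\<exists>r. SOME_bar (4 * n + 2) = 32 * (sq_weighted * odd_part rho) $ n + 256 * r"
proof -
  obtain r where r: "SOME_2 = 32 * (sq_weighted * odd_part rho) + 256 * r"
    using SOME_2_cong by (rule exE)
  have "SOME_bar (4 * n + 2) = (32 * (sq_weighted * odd_part rho) + 256 * r) $ n"
    by (simp only: nth_SOME_2[symmetric] r)
  then have "SOME_bar (4 * n + 2) = 32 * (sq_weighted * odd_part rho) $ n + 256 * r $ n"
    by simp
  then show ?thesis by blast
qed

text \<open>The index $2n+1$ is 3 modulo 4, hence not a sum of two squares.\<close>

lemma odd_part_rho_odd:
  assumes "odd n"
  shows "odd_part rho $ n = 0"
proof (rule ccontr)
  assume "odd_part rho $ n \<noteq> 0"
  then obtain x y where "2 * n + 1 = x\<^sup>2 + y\<^sup>2" by (auto elim: rho_nonzero)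
  moreover have "(2 * n + 1) mod 4 = 3" using assms by presburger
  moreover have "(x\<^sup>2 + y\<^sup>2) mod 4 = (x\<^sup>2 mod 4 + y\<^sup>2 mod 4) mod 4"
    by (intro mod_add_cong) simp_all
  ultimately show False using square_mod(1)[of x] square_mod(1)[of y] by auto
qed

lemma odd_part_rho_2_mod_4:
  assumes "n mod 4 = 2"
  shows "2 dvd odd_part rho $ n"
proof -
  have "(2 * n + 1) mod 8 = 5" using assms by presburger
  then show ?thesis using rho_even_5_mod_8 by simp
qed

text \<open>The weighted square is even because its cofactor lives in even degrees. So it is either divisible
  by 8, or 4 modulo 8, in which case the cofactor is even.\<close>

lemma sq_weighted_odd_part_rho_2_mod_4:
  assumes "n mod 4 = 2"
  shows "8 dvd (sq_weighted * odd_part rho) $ n"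
proof (rule dvd_nth_mult)
  fix i j assume n: "i + j = n" and nz: "sq_weighted $ i \<noteq> 0" "odd_part rho $ j \<noteq> 0"
  then have "8 dvd i \<or> i mod 8 = 1 \<or> i mod 8 = 4" using sq_weighted_index(2) by blast
  moreover have "even j" using odd_part_rho_odd nz(2) by blast
  moreover have "even n" using assms by presburger
  then have "even i" using n \<open>even j\<close> by auto
  then have "i mod 8 \<noteq> 1" by presburger
  ultimately consider "8 dvd i" | "i mod 8 = 4" by blast
  then show "8 dvd sq_weighted $ i * odd_part rho $ j"
  proof cases
    case 1
    then show ?thesis by (rule dvd_sq_weighted(2))
  next
    case 2
    then have i4: "4 dvd i" by (intro dvd_mod_imp_dvd[of 4 i 8]) simp_all
    then have "j mod 4 = 2" using assms by (intro complement_mod[OF n, of 4 0]) simp_all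
    then have "2 dvd odd_part rho $ j" by (rule odd_part_rho_2_mod_4)
    moreover have "4 dvd sq_weighted $ i" using i4 by (rule dvd_sq_weighted(1))
    ultimately have "4 * 2 dvd sq_weighted $ i * odd_part rho $ j" by (intro mult_dvd_mono)
    then show ?thesis by simp
  qed
qed

lemma sq_weighted_odd_part_rho_even:
  assumes "even n"
  shows "4 dvd (sq_weighted * odd_part rho) $ n"
proof (rule dvd_nth_mult)
  fix i j assume n: "i + j = n" and nz: "sq_weighted $ i \<noteq> 0" "odd_part rho $ j \<noteq> 0"
  then have "4 dvd i \<or> i mod 8 = 1" using sq_weighted_index(1) by blast
  moreover have "even j" using odd_part_rho_odd nz(2) by blast
  ultimately have "4 dvd i" using n assms by presburger
  then show "4 dvd sq_weighted $ i * odd_part rho $ j" by (rule dvd_sq_weighted(2))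
qed

lemma sq_weighted_odd_part_rho_3_mod_4:
  assumes "n mod 4 = 3"
  shows "2 dvd (sq_weighted * odd_part rho) $ n"
proof (rule dvd_nth_mult)
  fix i j assume n: "i + j = n" and nz: "sq_weighted $ i \<noteq> 0"
  then consider "4 dvd i" | "i mod 8 = 1" using sq_weighted_index(1) by blast
  then show "2 dvd sq_weighted $ i * odd_part rho $ j"
  proof cases
    case 1
    then have "2 dvd i" by presburger
    then show ?thesis by (rule dvd_sq_weighted(2))
  next
    case 2
    then have "i mod 4 = 1" by presburger
    then have "j mod 4 = 2" using assms by (intro complement_mod[OF n, of 4 1]) simp_all
    then have "2 dvd odd_part rho $ j" by (rule odd_part_rho_2_mod_4)
    then show ?thesis by (rule dvd_mult)
  qed
qed

lemma nonsquare_residues: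
  fixes x :: nat
  assumes "n mod 4 = 3 \<or> n mod 8 \<in> {5, 6, 7} \<or> n mod 16 = 12 \<or> n mod 32 \<in> {20, 24, 28}"
  shows "n \<noteq> x\<^sup>2"
proof -
  have "n mod 4 \<notin> {0, 1} \<or> n mod 8 \<notin> {0, 1, 4} \<or> n mod 16 \<notin> {0, 1, 4, 9} \<or>
      n mod 32 \<notin> {0, 1, 4, 9, 16, 17, 25}"
    using assms by (elim disjE insertE emptyE) simp_all
  then show ?thesis using square_mod[of x] by metis
qed

lemma nonsquare_times_16:
  assumes "\<And>y. n \<noteq> y\<^sup>2"
  shows "16 * n \<noteq> (x::nat)\<^sup>2"
proof
  assume x: "16 * n = x\<^sup>2"
  then have "4\<^sup>2 * n = x\<^sup>2" by simp
  then have "4\<^sup>2 dvd x\<^sup>2" by (metis dvd_triv_left)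
  then have "4 dvd x" by (simp only: pow_divides_pow_iff zero_less_numeral)
  then obtain y where "x = 4 * y" by (elim dvdE)
  then have "n = y\<^sup>2" using x by (simp add: power2_eq_square)
  then show False using assms by blast
qed

text \<open>Every power of two that divides the coefficient, up to $2^3$, adds to the basic modulus 32;
  beyond that the error term modulo 256 interferes.\<close>

lemma SOME_bar_2_mod_4_cong:
  assumes "2 ^ k dvd (sq_weighted * odd_part rho) $ m" "k \<le> 3" "N = 4 * m + 2" "e = k + 5"
  shows "[SOME_bar N = 0] (mod 2 ^ e)"
proof -
  obtain r where r: "SOME_bar N = 32 * (sq_weighted * odd_part rho) $ m + 256 * r"
    unfolding assms(3) using SOME_2_256 by (rule exE)
  have "(2::int) ^ k dvd 2 ^ 3" using assms(2) by (rule le_imp_power_dvd)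
  then have "2 ^ k dvd (sq_weighted * odd_part rho) $ m + 8 * r" using assms(1) by simp
  then have "2 ^ k * 32 dvd ((sq_weighted * odd_part rho) $ m + 8 * r) * 32"
    by (intro mult_dvd_mono) simp_all
  then show ?thesis unfolding r assms(4) by (simp add: cong_0_iff power_add algebra_simps)
qed

lemma SOME_bar_0_mod_4_cong:
  assumes "2 ^ k dvd (sq_weighted * rho) $ m" "\<And>x. m \<noteq> x\<^sup>2" "k \<le> 3" "N = 4 * m" "e = k + 5"
  shows "[SOME_bar N = 0] (mod 2 ^ e)"
proof -
  obtain r where r: "SOME_bar N = 96 * (sq_weighted * rho) $ m + 256 * r"
    unfolding assms(4) using SOME_0_256[OF assms(2)] by (rule exE)
  have "(2::int) ^ k dvd 2 ^ 3" using assms(3) by (rule le_imp_power_dvd)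
  then have "2 ^ k dvd 3 * (sq_weighted * rho) $ m + 8 * r" using assms(1) by simp
  then have "2 ^ k * 32 dvd (3 * (sq_weighted * rho) $ m + 8 * r) * 32"
    by (intro mult_dvd_mono) simp_all
  then show ?thesis unfolding r assms(5) by (simp add: cong_0_iff power_add algebra_simps)
qed

theorem theorem14:
  fixes n :: nat
  shows "[SOME_bar (4 * n + 2) = 0] (mod 2 ^ 5) \<and>
    [SOME_bar (8 * n + 2) = 0] (mod 2 ^ 7) \<and>
    [SOME_bar (16 * n + 10) = 0] (mod 2 ^ 8) \<and>
    [SOME_bar (16 * n + 14) = 0] (mod 2 ^ 6) \<and>
    [SOME_bar (16 * n + 12) = 0] (mod 2 ^ 5) \<and>
    [SOME_bar (32 * n + 28) = 0] (mod 2 ^ 7) \<and>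
    [SOME_bar (32 * n + 20) = 0] (mod 2 ^ 5) \<and>
    [SOME_bar (32 * n + 24) = 0] (mod 2 ^ 6) \<and>
    [SOME_bar (128 * n + 80) = 0] (mod 2 ^ 7) \<and>
    [SOME_bar (64 * n + 48) = 0] (mod 2 ^ 7) \<and>
    [SOME_bar (128 * n + 112) = 0] (mod 2 ^ 8) \<and>
    [SOME_bar (128 * n + 96) = 0] (mod 2 ^ 8) \<and>
    [SOME_bar (256 * n + 192) = 0] (mod 2 ^ 9) \<and>
    [SOME_bar (512 * n + 320) = 0] (mod 2 ^ 9)"
proof (intro conjI)
  show "[SOME_bar (4 * n + 2) = 0] (mod 2 ^ 5)"
  proof (rule SOME_bar_2_mod_4_cong)
    show "2 ^ 0 dvd (sq_weighted * odd_part rho) $ (n)"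
      by simp
  qed simp_all
  show "[SOME_bar (8 * n + 2) = 0] (mod 2 ^ 7)"
  proof (rule SOME_bar_2_mod_4_cong)
    show "2 ^ 2 dvd (sq_weighted * odd_part rho) $ (2 * n)"
      using sq_weighted_odd_part_rho_even[of "2 * n"] by simp
  qed simp_all
  show "[SOME_bar (16 * n + 10) = 0] (mod 2 ^ 8)"
  proof (rule SOME_bar_2_mod_4_cong)
    show "2 ^ 3 dvd (sq_weighted * odd_part rho) $ (4 * n + 2)"
    proof -
      have "(4 * n + 2) mod 4 = 2" by (subst mod_mult_self4) simp
      from sq_weighted_odd_part_rho_2_mod_4[OF this] show ?thesis by simp
    qed
  qed simp_all
  show "[SOME_bar (16 * n + 14) = 0] (mod 2 ^ 6)"
  proof (rule SOME_bar_2_mod_4_cong)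
    show "2 ^ 1 dvd (sq_weighted * odd_part rho) $ (4 * n + 3)"
    proof -
      have "(4 * n + 3) mod 4 = 3" by (subst mod_mult_self4) simp
      from sq_weighted_odd_part_rho_3_mod_4[OF this] show ?thesis by simp
    qed
  qed simp_all
  have m: "(4 * n + 3) mod 4 = 3" by (subst mod_mult_self4) simp
  show "[SOME_bar (16 * n + 12) = 0] (mod 2 ^ 5)"
  proof (rule SOME_bar_0_mod_4_cong)
    show "2 ^ 0 dvd (sq_weighted * rho) $ (4 * n + 3)"
      by simp
    show "4 * n + 3 \<noteq> x\<^sup>2" for x
      by (rule nonsquare_residues) (simp only: m simp_thms insert_iff)
  qed simp_all
  have m: "(8 * n + 7) mod 8 = 7" by (subst mod_mult_self4) simp
  show "[SOME_bar (32 * n + 28) = 0] (mod 2 ^ 7)"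
  proof (rule SOME_bar_0_mod_4_cong)
    show "2 ^ 2 dvd (sq_weighted * rho) $ (8 * n + 7)"
      using sq_weighted_rho_eq_0[of "8 * n + 7"] m by simp
    show "8 * n + 7 \<noteq> x\<^sup>2" for x
      by (rule nonsquare_residues) (simp only: m simp_thms insert_iff)
  qed simp_all
  have m: "(8 * n + 5) mod 8 = 5" by (subst mod_mult_self4) simp
  show "[SOME_bar (32 * n + 20) = 0] (mod 2 ^ 5)"
  proof (rule SOME_bar_0_mod_4_cong)
    show "2 ^ 0 dvd (sq_weighted * rho) $ (8 * n + 5)"
      by simp
    show "8 * n + 5 \<noteq> x\<^sup>2" for x
      by (rule nonsquare_residues) (simp only: m simp_thms insert_iff)
  qed simp_all
  have m: "(8 * n + 6) mod 8 = 6" by (subst mod_mult_self4) simp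
  show "[SOME_bar (32 * n + 24) = 0] (mod 2 ^ 6)"
  proof (rule SOME_bar_0_mod_4_cong)
    show "2 ^ 1 dvd (sq_weighted * rho) $ (8 * n + 6)"
      using sq_weighted_rho_mod_8_6[OF m] by simp
    show "8 * n + 6 \<noteq> x\<^sup>2" for x
      by (rule nonsquare_residues) (simp only: m simp_thms insert_iff)
  qed simp_all
  have m: "(32 * n + 20) mod 32 = 20" by (subst mod_mult_self4) simp
  show "[SOME_bar (128 * n + 80) = 0] (mod 2 ^ 7)"
  proof (rule SOME_bar_0_mod_4_cong)
    show "2 ^ 2 dvd (sq_weighted * rho) $ (32 * n + 20)"
      using sq_weighted_rho_dvd_4[of "32 * n + 20"] by simp
    show "32 * n + 20 \<noteq> x\<^sup>2" for x
      by (rule nonsquare_residues) (simp only: m simp_thms insert_iff)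
  qed simp_all
  have m: "(16 * n + 12) mod 16 = 12" by (subst mod_mult_self4) simp
  show "[SOME_bar (64 * n + 48) = 0] (mod 2 ^ 7)"
  proof (rule SOME_bar_0_mod_4_cong)
    show "2 ^ 2 dvd (sq_weighted * rho) $ (16 * n + 12)"
      using sq_weighted_rho_dvd_4[of "16 * n + 12"] by simp
    show "16 * n + 12 \<noteq> x\<^sup>2" for x
      by (rule nonsquare_residues) (simp only: m simp_thms insert_iff)
  qed simp_all
  have m: "(32 * n + 28) mod 32 = 28" by (subst mod_mult_self4) simp
  show "[SOME_bar (128 * n + 112) = 0] (mod 2 ^ 8)"
  proof (rule SOME_bar_0_mod_4_cong)
    show "2 ^ 3 dvd (sq_weighted * rho) $ (32 * n + 28)"
      using sq_weighted_rho_eq_0[of "32 * n + 28"] m by simp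
    show "32 * n + 28 \<noteq> x\<^sup>2" for x
      by (rule nonsquare_residues) (simp only: m simp_thms insert_iff)
  qed simp_all
  have m: "(32 * n + 24) mod 32 = 24" by (subst mod_mult_self4) simp
  show "[SOME_bar (128 * n + 96) = 0] (mod 2 ^ 8)"
  proof (rule SOME_bar_0_mod_4_cong)
    show "2 ^ 3 dvd (sq_weighted * rho) $ (32 * n + 24)"
      using sq_weighted_rho_mod_32_24[OF m] by simp
    show "32 * n + 24 \<noteq> x\<^sup>2" for x
      by (rule nonsquare_residues) (simp only: m simp_thms insert_iff)
  qed simp_all
  have m: "(4 * n + 3) mod 4 = 3" by (subst mod_mult_self4) simp
  have "512 dvd SOME_bar (4 * (16 * (4 * n + 3)))"
  proof (rule SOME_0_512)
    show "16 * (4 * n + 3) \<noteq> x\<^sup>2" for x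
      by (intro nonsquare_times_16 nonsquare_residues) (simp only: m simp_thms insert_iff)
  qed simp
  then show "[SOME_bar (256 * n + 192) = 0] (mod 2 ^ 9)"
    by (simp add: cong_0_iff algebra_simps)
  have m: "(8 * n + 5) mod 8 = 5" by (subst mod_mult_self4) simp
  have "512 dvd SOME_bar (4 * (16 * (8 * n + 5)))"
  proof (rule SOME_0_512)
    show "16 * (8 * n + 5) \<noteq> x\<^sup>2" for x
      by (intro nonsquare_times_16 nonsquare_residues) (simp only: m simp_thms insert_iff)
  qed simp
  then show "[SOME_bar (512 * n + 320) = 0] (mod 2 ^ 9)"
    by (simp add: cong_0_iff algebra_simps)
qed
end
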